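(* Let $G$ be a connected $m$-uniform hypergraph on $n$ vertices, and suppose the incidence matrix $B_G$ has a Smith normal form over $\mathbb{Z}_m$ with invariant divisors $d_1,\dots,d_r$. Then $1\le r\le n-1$ and $$\mathbb{P}V_0^{\mathcal L}(G)\cong \mathbb{P}S_0^{\mathcal L}(G)\cong \bigoplus_{i:\,d_i\neq 1}\mathbb{Z}_{d_i}\oplus \underbrace{\mathbb{Z}_m\oplus\cdots\oplus\mathbb{Z}_m}_{n-1-r\text{ copies}}$$ as $\mathbb{Z}_m$-modules. Consequently, $G$ has exactly $m^{n-1-r}\prod_{i=1}^r d_i$ first Laplacian eigenvectors (counted up to scalar), and the composition length of the $\mathbb{Z}_m$-module $\mathbb{P}V_0^{\mathcal L}(G)$ is $\sum_{i:\,d_i\ne1}\mathrm{cl}(d_i)+(n-1-r)\,\mathrm{cl}(m)$.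
   Context: An $m$-uniform hypergraph $G$ on vertex set $[n]$ has edge set consisting of $m$-element subsets of $[n]$. Its adjacency tensor $\mathcal{A}(G)$ has entry $\frac{1}{(m-1)!}$ at $(i_1,\dots,i_m)$ if $\{i_1,\dots,i_m\}$ is an edge and $0$ otherwise; $\mathcal{D}(G)$ is the diagonal tensor of vertex degrees; $\mathcal{L}(G)=\mathcal{D}(G)-\mathcal{A}(G)$ is the Laplacian tensor. For a tensor $\mathcal{T}$, $(\mathcal{T}x^{m-1})_i=\sum_{i_2,\dots,i_m}t_{ii_2\cdots i_m}x_{i_2}\cdots x_{i_m}$. A first Laplacian eigenvector is a nonzero $x\in\mathbb{C}^n$ with $\mathcal{L}(G)x^{m-1}=0$; eigenvectors are counted as points of $\mathbb{P}^{n-1}$, and $\mathbb{P}V_0^{\mathcal L}(G)=\{x\in\mathbb{P}^{n-1}:\mathcal{L}(G)x^{m-1}=0\}$. Every such point has all coordinates nonzero and a unique representative with $x_1=1$; $\mathbb{P}V_0^{\mathcal L}(G)$ is a $\mathbb{Z}_m$-module under the Hadamard (entrywise) product of these representatives, with $k\in\mathbb{Z}_m$ acting by entrywise $k$-th power. The incidence matrix $B_G$ is the $|E(G)|\times n$ 0/1 matrix with $(e,v)$ entry $1$ iff $v\in e$, and $\mathbb{P}S_0^{\mathcal L}(G)=\{y\in\mathbb{Z}_m^n:B_Gy=0,\ y_1=0\}$. A Smith normal form of $B\in\mathbb{Z}_m^{k\times n}$ over $\mathbb{Z}_m$ is a matrix $PBQ$ with $P,Q$ invertible over $\mathbb{Z}_m$,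 such that $PBQ$ has diagonal entries $d_1,\dots,d_r$ (in positions $(1,1),\dots,(r,r)$) and all other entries $0$, where $r\ge0$, $1\le d_i\le m-1$, $d_i\mid d_{i+1}$, and $d_i\mid m$; the $d_i$ are the invariant divisors. For $d=p_1^{k_1}\cdots p_s^{k_s}$ (distinct primes), $\mathrm{cl}(d)=\sum k_i$; the composition length of a finitely generated $\mathbb{Z}_m$-module $\bigoplus_i\mathbb{Z}_{p_i^{k_i}}$ is $\sum_i k_i$. *)

theory Defs
  imports
    Complex_Main
    "Jordan_Normal_Form.VS_Connect"
    "Berlekamp_Zassenhaus.Finite_Field"
begin

text \<open>
  Conventions. The vertex set \<open>[n]\<close> is \<open>{0..<n}\<close>, so the distinguished vertex \<open>1\<close> is \<open>0\<close> here.
  The ring \<open>\<int>\<^sub>m\<close> is the type \<^typ>\<open>'m::nontriv mod_ring\<close> with \<open>CARD('m) = m \<ge> 2\<close>; as a ring record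
  it is \<^term>\<open>class_ring\<close>.
\<close>

section \<open>Uniform hypergraphs\<close>

definition uniform_hypergraph :: "nat \<Rightarrow> nat \<Rightarrow> nat set set \<Rightarrow> bool" where
  "uniform_hypergraph m n E \<longleftrightarrow> (\<forall>e\<in>E. e \<subseteq> {0..<n} \<and> card e = m)"

definition connected_hypergraph :: "nat \<Rightarrow> nat set set \<Rightarrow> bool" where
  "connected_hypergraph n E \<longleftrightarrow>
     (\<forall>u<n. \<forall>v<n. (u, v) \<in> {(a, b). \<exists>e\<in>E. a \<in> e \<and> b \<in> e}\<^sup>*)"

definition vertex_degree :: "nat set set \<Rightarrow> nat \<Rightarrow> nat" where
  "vertex_degree E v = card {e \<in> E. v \<in> e}"

text \<open>The rows of the incidence matrix follow an enumeration \<open>es\<close> of the edges.\<close>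

definition incidence_mat :: "nat \<Rightarrow> nat set list \<Rightarrow> 'a::{zero,one} mat" where
  "incidence_mat n es = mat (length es) n (\<lambda>(i, v). if v \<in> es ! i then 1 else 0)"


section \<open>The Laplacian tensor and its first eigenvectors\<close>

text \<open>
  A tensor of order \<open>m\<close> and dimension \<open>n\<close> is a function on index lists; only its values on lists
  of length \<open>m\<close> with entries below \<open>n\<close> matter.
\<close>

type_synonym tensor = "nat list \<Rightarrow> complex"

definition adjacency_tensor :: "nat \<Rightarrow> nat set set \<Rightarrow> tensor" where
  "adjacency_tensor m E is = (if set is \<in> E then 1 / fact (m - 1) else 0)"

definition degree_tensor :: "nat set set \<Rightarrow> tensor" where
  "degree_tensor E is = (if set is = {hd is} then of_nat (vertex_degree E (hd is)) else 0)"

definition laplacian_tensor :: "nat \<Rightarrow> nat set set \<Rightarrow> tensor" where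
  "laplacian_tensor m E is = degree_tensor E is - adjacency_tensor m E is"

definition tensor_apply :: "nat \<Rightarrow> nat \<Rightarrow> tensor \<Rightarrow> complex vec \<Rightarrow> complex vec" where
  "tensor_apply m n T x =
     vec n (\<lambda>i. \<Sum>is\<in>{is. length is = m - 1 \<and> set is \<subseteq> {0..<n}}.
       T (i # is) * prod_list (map (\<lambda>j. x $ j) is))"

definition first_laplacian_eigenvector :: "nat \<Rightarrow> nat \<Rightarrow> nat set set \<Rightarrow> complex vec \<Rightarrow> bool" where
  "first_laplacian_eigenvector m n E x \<longleftrightarrow>
     x \<in> carrier_vec n \<and> x \<noteq> 0\<^sub>v n \<and> tensor_apply m n (laplacian_tensor m E) x = 0\<^sub>v n"

text \<open>A point of complex projective space is the set of all nonzero multiples of a nonzero vector.\<close>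

definition proj_point :: "complex vec \<Rightarrow> complex vec set" where
  "proj_point x = {c \<cdot>\<^sub>v x | c. c \<noteq> 0}"

definition PV0 :: "nat \<Rightarrow> nat \<Rightarrow> nat set set \<Rightarrow> complex vec set set" where
  "PV0 m n E = proj_point ` {x. first_laplacian_eigenvector m n E x}"

definition normalized_rep :: "complex vec set \<Rightarrow> complex vec" where
  "normalized_rep p = (THE x. x \<in> p \<and> x $ 0 = 1)"

definition PV0_module ::
  "nat \<Rightarrow> nat set set \<Rightarrow> ('m::nontriv mod_ring, complex vec set) module" where
  "PV0_module n E = \<lparr>
     carrier = PV0 CARD('m) n E,
     monoid.mult = undefined,
     one = undefined,
     zero = proj_point (vec n (\<lambda>i. 1)),
     add = (\<lambda>p q. proj_point (vec n (\<lambda>i. normalized_rep p $ i * normalized_rep q $ i))),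
     module.smult = (\<lambda>k p. proj_point (vec n (\<lambda>i. normalized_rep p $ i ^ nat (to_int_mod_ring k))))
   \<rparr>"


section \<open>The solutions of the incidence system, and Smith normal forms\<close>

definition PS0 :: "nat \<Rightarrow> 'm::nontriv mod_ring mat \<Rightarrow> 'm mod_ring vec set" where
  "PS0 n B = {y \<in> carrier_vec n. B *\<^sub>v y = 0\<^sub>v (dim_row B) \<and> y $ 0 = 0}"

definition PS0_module ::
  "nat \<Rightarrow> 'm::nontriv mod_ring mat \<Rightarrow> ('m mod_ring, 'm mod_ring vec) module" where
  "PS0_module n B = (module_vec TYPE('m mod_ring) n)\<lparr>carrier := PS0 n B\<rparr>"

definition smith_form :: "'m::nontriv mod_ring mat \<Rightarrow> nat list \<Rightarrow> bool" where
  "smith_form S ds \<longleftrightarrow>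
     length ds \<le> dim_row S \<and> length ds \<le> dim_col S \<and>
     (\<forall>i<length ds. 1 \<le> ds ! i \<and> ds ! i \<le> CARD('m) - 1 \<and> ds ! i dvd CARD('m)) \<and>
     (\<forall>i. Suc i < length ds \<longrightarrow> ds ! i dvd ds ! Suc i) \<and>
     (\<forall>i<dim_row S. \<forall>j<dim_col S.
        S $$ (i, j) = (if i = j \<and> i < length ds then of_nat (ds ! i) else 0))"

definition has_smith_normal_form :: "'m::nontriv mod_ring mat \<Rightarrow> nat list \<Rightarrow> bool" where
  "has_smith_normal_form B ds \<longleftrightarrow>
     (\<exists>P Q. P \<in> carrier_mat (dim_row B) (dim_row B) \<and> invertible_mat P \<and>
            Q \<in> carrier_mat (dim_col B) (dim_col B) \<and> invertible_mat Q \<and>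
            smith_form (P * B * Q) ds)"


section \<open>Modules over the integers modulo m\<close>

text \<open>
  The locale \<^locale>\<open>mod_hom\<close> contains the assertions that \<open>M\<close> and \<open>N\<close> are modules over the ring.
\<close>

definition module_isomorphic ::
  "('m::nontriv mod_ring, 'a) module \<Rightarrow> ('m mod_ring, 'b) module \<Rightarrow> bool"  (infix \<open>\<cong>\<^sub>M\<close> 50) where
  "M \<cong>\<^sub>M N \<longleftrightarrow> (\<exists>f. mod_hom class_ring M N f \<and> bij_betw f (carrier M) (carrier N))"

text \<open>\<open>\<int>\<^sub>d\<close> as a module over \<open>\<int>\<^sub>m\<close>; the action is well-defined when \<open>d\<close> divides \<open>m\<close>.\<close>

definition cyclic_module :: "nat \<Rightarrow> ('m::nontriv mod_ring, int) module" where
  "cyclic_module d = \<lparr>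
     carrier = {0..<int d},
     monoid.mult = undefined,
     one = undefined,
     zero = 0,
     add = (\<lambda>a b. (a + b) mod int d),
     module.smult = (\<lambda>k a. (to_int_mod_ring k * a) mod int d)
   \<rparr>"

definition direct_sum_list :: "('r, 'a) module list \<Rightarrow> ('r, 'a list) module" where
  "direct_sum_list Ms = \<lparr>
     carrier = {xs. length xs = length Ms \<and> (\<forall>i<length Ms. xs ! i \<in> carrier (Ms ! i))},
     monoid.mult = undefined,
     one = undefined,
     zero = map (\<lambda>M. \<zero>\<^bsub>M\<^esub>) Ms,
     add = (\<lambda>xs ys. map (\<lambda>i. xs ! i \<oplus>\<^bsub>Ms ! i\<^esub> ys ! i) [0..<length Ms]),
     module.smult = (\<lambda>k xs. map (\<lambda>i. k \<odot>\<^bsub>Ms ! i\<^esub> xs ! i) [0..<length Ms])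
   \<rparr>"

definition cl :: "nat \<Rightarrow> nat" where
  "cl d = size (prime_factorization d)"

text \<open>
  The composition length of a finitely generated module over \<open>\<int>\<^sub>m\<close> is the sum of the exponents \<open>k\<close>
  in a decomposition into cyclic modules of prime power orders \<open>p^k\<close>.
\<close>

definition composition_length :: "('m::nontriv mod_ring, 'a) module \<Rightarrow> nat" where
  "composition_length M = (THE l. \<exists>pks :: (nat \<times> nat) list.
     (\<forall>(p, k)\<in>set pks. prime p \<and> 1 \<le> k \<and> p ^ k dvd CARD('m)) \<and>
     M \<cong>\<^sub>M direct_sum_list (map (\<lambda>(p, k). cyclic_module (p ^ k)) pks) \<and>
     l = sum_list (map snd pks))"

end

theory Submission
  imports Defs "HOL-Combinatorics.Multiset_Permutations"
begin

text \<open>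
  Let \<open>x\<close> be a first Laplacian eigenvector. At a vertex \<open>i\<close> where \<open>\<bar>x $ i\<bar>\<close> is maximal, the eigenvalue
  equation writes \<open>deg(i) * x $ i ^ (m - 1)\<close> as a sum of \<open>deg(i)\<close> numbers of at most the modulus of
  \<open>x $ i ^ (m - 1)\<close>, so all of them are equal to it. By connectedness all coordinates have the same
  modulus, all \<open>x $ i ^ m\<close> coincide, and they equal the product of the coordinates over any edge.
  Normalized at the distinguished vertex, \<open>x\<close> is therefore the exponential of a solution of the
  incidence system over \<open>\<int>\<^sub>m\<close>.

  In Smith coordinates the kernel of the incidence matrix is the direct sum of the \<open>\<int>\<^bsub>d\<^esub>\<close> and
  of \<open>n - r\<close> copies of \<open>\<int>\<^sub>m\<close>. The all-ones vector spans a free summand, and since \<open>\<int>\<^sub>m\<close> has stable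
  range 1 this summand can be cancelled against one copy of \<open>\<int>\<^sub>m\<close>. The composition length is the number
  of prime factors of the cardinality, whatever decomposition is used.
\<close>

section \<open>Isomorphisms of modules over the integers modulo m\<close>

text \<open>The delicate point is the condition \<open>y $ 0 = 0\<close>. It singles out a
  complement of the line through the all-ones vector, but in Smith coordinates it becomes an
  equation whose coefficients are the top row of \<open>Q\<close>. The coefficient of a free
  coordinate need not be a unit of Z_m, so the equation cannot simply be solved for that coordinate.
  The remedy is to trade the functional for another one that also takes the value 1 on the all-ones
  vector and has a unit coefficient at the last coordinate: two complements of the same line are
  isomorphic, whatever functionals define them. The last coordinate is free because r < n: if all n
  coordinates were annihilated by divisors, the last divisor would annihilate the all-ones vector,
  whose order is m. The remaining free coordinates are treated as torsion with the divisor m, which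
  is 0 in Z_m, so that one argument handles both kinds of summands.\<close>

lemma module_isomorphicI:
  fixes M :: "('m::nontriv mod_ring, 'a) module" and N :: "('m mod_ring, 'b) module"
  assumes M: "Module.module class_ring M" and bij: "bij_betw f (carrier M) (carrier N)"
    and zero: "f \<zero>\<^bsub>M\<^esub> = \<zero>\<^bsub>N\<^esub>"
    and add: "\<And>x y. x \<in> carrier M \<Longrightarrow> y \<in> carrier M \<Longrightarrow> f (x \<oplus>\<^bsub>M\<^esub> y) = f x \<oplus>\<^bsub>N\<^esub> f y"
    and smult: "\<And>k x. x \<in> carrier M \<Longrightarrow> f (k \<odot>\<^bsub>M\<^esub> x) = k \<odot>\<^bsub>N\<^esub> f x"
  shows "M \<cong>\<^sub>M N"
proof -
  interpret M: Module.module class_ring M by (rule M)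
  have img: "f x \<in> carrier N" if "x \<in> carrier M" for x
    using that bij by (auto simp: bij_betw_def)
  have pre: "\<exists>x\<in>carrier M. y = f x" if "y \<in> carrier N" for y
    using that bij by (auto simp: bij_betw_def)
  \<comment> \<open>Only \<open>M\<close> is assumed to be a module: the axioms for \<open>N\<close>
    are carried over along the surjection \<open>f\<close>. The modules of eigenvectors and of
    annihilated vectors obtain their axioms in this way from the solution module.\<close>
  have "abelian_group N"
  proof (rule abelian_groupI)
    show "\<zero>\<^bsub>N\<^esub> \<in> carrier N" using img[OF M.zero_closed] zero by simp
  next
    fix a b assume "a \<in> carrier N" "b \<in> carrier N"
    then obtain x y where xy: "x \<in> carrier M" "a = f x" "y \<in> carrier M" "b = f y"
      using pre by metis
    show "a \<oplus>\<^bsub>N\<^esub> b \<in> carrier N"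
      using xy img[of "x \<oplus>\<^bsub>M\<^esub> y"] by (simp add: add)
    show "a \<oplus>\<^bsub>N\<^esub> b = b \<oplus>\<^bsub>N\<^esub> a"
      using xy by (simp add: add[symmetric] M.a_comm)
    fix c assume "c \<in> carrier N"
    then obtain z where z: "z \<in> carrier M" "c = f z" using pre by metis
    show "a \<oplus>\<^bsub>N\<^esub> b \<oplus>\<^bsub>N\<^esub> c = a \<oplus>\<^bsub>N\<^esub> (b \<oplus>\<^bsub>N\<^esub> c)"
      using xy z by (simp add: add[symmetric] M.a_assoc)
  next
    fix a assume "a \<in> carrier N"
    then obtain x where x: "x \<in> carrier M" "a = f x" using pre by metis
    show "\<zero>\<^bsub>N\<^esub> \<oplus>\<^bsub>N\<^esub> a = a"
      using x by (simp add: add[symmetric] zero[symmetric])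
    show "\<exists>y\<in>carrier N. y \<oplus>\<^bsub>N\<^esub> a = \<zero>\<^bsub>N\<^esub>"
      using x img[of "\<ominus>\<^bsub>M\<^esub> x"]
      by (intro bexI[of _ "f (\<ominus>\<^bsub>M\<^esub> x)"]) (auto simp: add[symmetric] zero[symmetric] M.l_neg)
  qed
  moreover have "Module.module_axioms class_ring N"
  proof
    fix a b :: "'m mod_ring" and u v
    assume "u \<in> carrier N" "v \<in> carrier N"
    then obtain x y where xy: "x \<in> carrier M" "u = f x" "y \<in> carrier M" "v = f y"
      using pre by metis
    show "a \<odot>\<^bsub>N\<^esub> u \<in> carrier N"
      using xy img[of "a \<odot>\<^bsub>M\<^esub> x"] by (simp add: smult)
    show "(a \<oplus>\<^bsub>class_ring\<^esub> b) \<odot>\<^bsub>N\<^esub> u = a \<odot>\<^bsub>N\<^esub> u \<oplus>\<^bsub>N\<^esub> b \<odot>\<^bsub>N\<^esub> u"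
      using xy M.smult_l_distr[of a b x] by (simp add: smult[symmetric] add[symmetric])
    show "a \<odot>\<^bsub>N\<^esub> (u \<oplus>\<^bsub>N\<^esub> v) = a \<odot>\<^bsub>N\<^esub> u \<oplus>\<^bsub>N\<^esub> a \<odot>\<^bsub>N\<^esub> v"
      using xy M.smult_r_distr[of a x y] by (simp add: smult[symmetric] add[symmetric])
    show "(a \<otimes>\<^bsub>class_ring\<^esub> b) \<odot>\<^bsub>N\<^esub> u = a \<odot>\<^bsub>N\<^esub> (b \<odot>\<^bsub>N\<^esub> u)"
      using xy M.smult_assoc1[of a b x] by (simp add: smult[symmetric])
    show "\<one>\<^bsub>class_ring\<^esub> \<odot>\<^bsub>N\<^esub> u = u"
      using xy M.smult_one[of x] by (simp add: smult[symmetric])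
  qed
  ultimately have N: "Module.module class_ring N"
    by (simp add: Module.module_def class_cring.is_cring)
  have "f \<in> LinearCombinations.module_hom class_ring M N"
    unfolding LinearCombinations.module_hom_def using img by (auto simp: add smult)
  then show ?thesis
    unfolding module_isomorphic_def mod_hom_def mod_hom_axioms_def using M N bij by blast
qed

lemma module_isomorphic_modules:
  assumes "M \<cong>\<^sub>M N" shows "Module.module class_ring M" "Module.module class_ring N"
  using assms by (auto simp: module_isomorphic_def mod_hom_def)

lemma module_isomorphicE:
  fixes M :: "('m::nontriv mod_ring, 'a) module" and N :: "('m mod_ring, 'b) module"
  assumes "M \<cong>\<^sub>M N"
  obtains f where "bij_betw f (carrier M) (carrier N)" "f \<zero>\<^bsub>M\<^esub> = \<zero>\<^bsub>N\<^esub>"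
    "\<forall>x\<in>carrier M. \<forall>y\<in>carrier M. f (x \<oplus>\<^bsub>M\<^esub> y) = f x \<oplus>\<^bsub>N\<^esub> f y"
    "\<forall>k. \<forall>x\<in>carrier M. f (k \<odot>\<^bsub>M\<^esub> x) = k \<odot>\<^bsub>N\<^esub> f x"
proof -
  from assms obtain f where f: "mod_hom class_ring M N f" "bij_betw f (carrier M) (carrier N)"
    unfolding module_isomorphic_def by blast
  interpret mod_hom class_ring M N f by (rule f)
  show ?thesis by (rule that[OF f(2)]) auto
qed

lemma module_isomorphic_refl: "Module.module class_ring M \<Longrightarrow> M \<cong>\<^sub>M M"
  by (rule module_isomorphicI[where f = id]) auto

lemma module_isomorphic_sym:
  assumes "M \<cong>\<^sub>M N" shows "N \<cong>\<^sub>M M"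
proof -
  obtain f where f: "bij_betw f (carrier M) (carrier N)" "f \<zero>\<^bsub>M\<^esub> = \<zero>\<^bsub>N\<^esub>"
    "\<forall>x\<in>carrier M. \<forall>y\<in>carrier M. f (x \<oplus>\<^bsub>M\<^esub> y) = f x \<oplus>\<^bsub>N\<^esub> f y"
    "\<forall>k. \<forall>x\<in>carrier M. f (k \<odot>\<^bsub>M\<^esub> x) = k \<odot>\<^bsub>N\<^esub> f x"
    using module_isomorphicE[OF assms] by blast
  interpret M: Module.module class_ring M using assms by (rule module_isomorphic_modules)
  interpret N: Module.module class_ring N using assms by (rule module_isomorphic_modules)
  let ?g = "the_inv_into (carrier M) f"
  have inj: "inj_on f (carrier M)" and surj: "f ` carrier M = carrier N"
    using f(1) by (auto simp: bij_betw_def)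
  have gf: "?g (f x) = x" if "x \<in> carrier M" for x using the_inv_into_f_f[OF inj that] .
  have fg: "\<exists>x\<in>carrier M. y = f x" if "y \<in> carrier N" for y
    using that surj by blast
  show ?thesis
  proof (rule module_isomorphicI[OF module_isomorphic_modules(2)[OF assms] bij_betw_the_inv_into[OF f(1)]])
    show "?g \<zero>\<^bsub>N\<^esub> = \<zero>\<^bsub>M\<^esub>" using gf[of "\<zero>\<^bsub>M\<^esub>"] f(2) by simp
  next
    fix a b assume "a \<in> carrier N" "b \<in> carrier N"
    then obtain x y where xy: "x \<in> carrier M" "a = f x" "y \<in> carrier M" "b = f y"
      using fg by metis
    show "?g (a \<oplus>\<^bsub>N\<^esub> b) = ?g a \<oplus>\<^bsub>M\<^esub> ?g b"
      using xy gf[of "x \<oplus>\<^bsub>M\<^esub> y"] by (simp add: f(3) gf)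
  next
    fix k a assume "a \<in> carrier N"
    then obtain x where x: "x \<in> carrier M" "a = f x" using fg by metis
    show "?g (k \<odot>\<^bsub>N\<^esub> a) = k \<odot>\<^bsub>M\<^esub> ?g a"
      using x gf[of "k \<odot>\<^bsub>M\<^esub> x"] by (simp add: f(4) gf)
  qed
qed

lemma module_isomorphic_trans:
  assumes "L \<cong>\<^sub>M M" "M \<cong>\<^sub>M N" shows "L \<cong>\<^sub>M N"
proof -
  obtain f where f: "bij_betw f (carrier L) (carrier M)" "f \<zero>\<^bsub>L\<^esub> = \<zero>\<^bsub>M\<^esub>"
    "\<forall>x\<in>carrier L. \<forall>y\<in>carrier L. f (x \<oplus>\<^bsub>L\<^esub> y) = f x \<oplus>\<^bsub>M\<^esub> f y"
    "\<forall>k. \<forall>x\<in>carrier L. f (k \<odot>\<^bsub>L\<^esub> x) = k \<odot>\<^bsub>M\<^esub> f x"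
    using module_isomorphicE[OF assms(1)] by blast
  obtain g where g: "bij_betw g (carrier M) (carrier N)" "g \<zero>\<^bsub>M\<^esub> = \<zero>\<^bsub>N\<^esub>"
    "\<forall>x\<in>carrier M. \<forall>y\<in>carrier M. g (x \<oplus>\<^bsub>M\<^esub> y) = g x \<oplus>\<^bsub>N\<^esub> g y"
    "\<forall>k. \<forall>x\<in>carrier M. g (k \<odot>\<^bsub>M\<^esub> x) = k \<odot>\<^bsub>N\<^esub> g x"
    using module_isomorphicE[OF assms(2)] by blast
  have img: "f x \<in> carrier M" if "x \<in> carrier L" for x
    using that f(1) by (auto simp: bij_betw_def)
  show ?thesis
    by (rule module_isomorphicI[OF module_isomorphic_modules(1)[OF assms(1)] bij_betw_trans[OF f(1) g(1)]]) (simp_all add: f g img)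
qed

lemma module_isomorphic_card:
  assumes "M \<cong>\<^sub>M N" shows "card (carrier M) = card (carrier N)"
  using assms by (auto simp: module_isomorphic_def bij_betw_same_card)

section \<open>Integer representatives of residues\<close>

lemma to_int_mod_ring_range: "0 \<le> to_int_mod_ring a" "to_int_mod_ring (a :: 'm::nontriv mod_ring) < int CARD('m)"
  using range_to_int_mod_ring[where 'a = 'm] by force+

lemma to_int_mod_ring_add: "to_int_mod_ring (a + b :: 'm::nontriv mod_ring)
    = (to_int_mod_ring a + to_int_mod_ring b) mod int CARD('m)"
  by transfer simp

lemma to_int_mod_ring_mult: "to_int_mod_ring (a * b :: 'm::nontriv mod_ring)
    = (to_int_mod_ring a * to_int_mod_ring b) mod int CARD('m)"
  by transfer simp

lemma of_int_mod_ring_eq_0_iff: "(of_int a :: 'm::nontriv mod_ring) = 0 \<longleftrightarrow> int CARD('m) dvd a"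
  by transfer (simp add: dvd_eq_mod_eq_0)

lemma of_int_to_int_mod_ring: "(of_int (to_int_mod_ring a) :: 'm::nontriv mod_ring) = a"
  by (simp add: of_int_of_int_mod_ring)

section \<open>Direct sums of cyclic modules\<close>

lemma module_cyclic_module:
  assumes d: "d dvd CARD('m::nontriv)"
  shows "Module.module class_ring (cyclic_module d :: ('m mod_ring, int) module)"
proof -
  have d0: "0 < int d" using d by (cases "d = 0") auto
  \<comment> \<open>This congruence makes the action through representatives below
    \<open>CARD('m)\<close> compatible with sums and products of scalars.\<close>
  have dm: "a mod int CARD('m) mod int d = a mod int d" for a
    using d by (simp add: mod_mod_cancel)
  show ?thesis
  proof (rule moduleI)
    show "cring (class_ring :: 'm mod_ring ring)" by (rule class_cring.is_cring)
    show "abelian_group (cyclic_module d :: ('m mod_ring, int) module)"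
    proof (rule abelian_groupI)
      fix x assume x: "x \<in> carrier (cyclic_module d :: ('m mod_ring, int) module)"
      show "\<exists>y\<in>carrier (cyclic_module d :: ('m mod_ring, int) module).
          y \<oplus>\<^bsub>cyclic_module d\<^esub> x = \<zero>\<^bsub>cyclic_module d\<^esub>"
        using d0 by (intro bexI[of _ "(- x) mod int d"]) (auto simp: cyclic_module_def mod_simps)
    qed (use d0 in \<open>auto simp: cyclic_module_def mod_simps algebra_simps\<close>)
  next
    fix a b :: "'m mod_ring" and x assume x: "x \<in> carrier (cyclic_module d :: ('m mod_ring, int) module)"
    show "a \<odot>\<^bsub>cyclic_module d\<^esub> x \<in> carrier (cyclic_module d)"
      using d0 by (auto simp: cyclic_module_def)
    have "to_int_mod_ring (a + b) * x mod int d = (to_int_mod_ring a * x + to_int_mod_ring b * x) mod int d"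
    proof -
      have "to_int_mod_ring (a + b) mod int d = (to_int_mod_ring a + to_int_mod_ring b) mod int d"
        by (simp only: to_int_mod_ring_add dm)
      then show ?thesis by (metis mod_mult_left_eq distrib_right)
    qed
    then show "(a \<oplus>\<^bsub>class_ring\<^esub> b) \<odot>\<^bsub>cyclic_module d\<^esub> x =
      a \<odot>\<^bsub>cyclic_module d\<^esub> x \<oplus>\<^bsub>cyclic_module d\<^esub> b \<odot>\<^bsub>cyclic_module d\<^esub> x"
      by (simp add: cyclic_module_def mod_simps)
    have "to_int_mod_ring (a * b) * x mod int d = to_int_mod_ring a * (to_int_mod_ring b * x) mod int d"
    proof -
      have "to_int_mod_ring (a * b) mod int d = (to_int_mod_ring a * to_int_mod_ring b) mod int d"
        by (simp only: to_int_mod_ring_mult dm)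
      then show ?thesis by (metis mod_mult_left_eq mult.assoc)
    qed
    then show "(a \<otimes>\<^bsub>class_ring\<^esub> b) \<odot>\<^bsub>cyclic_module d\<^esub> x = a \<odot>\<^bsub>cyclic_module d\<^esub> (b \<odot>\<^bsub>cyclic_module d\<^esub> x)"
      by (simp add: cyclic_module_def mod_simps)
    show "\<one>\<^bsub>class_ring\<^esub> \<odot>\<^bsub>cyclic_module d\<^esub> x = x"
      using x by (simp add: cyclic_module_def)
    fix y
    show "a \<odot>\<^bsub>cyclic_module d\<^esub> (x \<oplus>\<^bsub>cyclic_module d\<^esub> y) =
      a \<odot>\<^bsub>cyclic_module d\<^esub> x \<oplus>\<^bsub>cyclic_module d\<^esub> a \<odot>\<^bsub>cyclic_module d\<^esub> y"
      by (simp add: cyclic_module_def mod_simps algebra_simps)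
  qed
qed

lemma module_direct_sum_list:
  fixes Ms :: "('m::nontriv mod_ring, 'a) module list"
  assumes "\<And>M. M \<in> set Ms \<Longrightarrow> Module.module class_ring M"
  shows "Module.module class_ring (direct_sum_list Ms)"
proof -
  have md: "Module.module class_ring (Ms ! i)" if "i < length Ms" for i
    using assms that by simp
  have ag: "abelian_group (Ms ! i)" if "i < length Ms" for i
    using md[OF that] by (simp add: Module.module_def)
  note ax = abelian_monoid.a_closed[OF abelian_group.axioms(1)[OF ag]]
    abelian_monoid.a_assoc[OF abelian_group.axioms(1)[OF ag]]
    abelian_monoid.zero_closed[OF abelian_group.axioms(1)[OF ag]]
    abelian_monoid.l_zero[OF abelian_group.axioms(1)[OF ag]]
    Module.module.smult_closed[OF md] Module.module.smult_l_distr[OF md, simplified]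
    Module.module.smult_r_distr[OF md] Module.module.smult_assoc1[OF md, simplified]
    Module.module.smult_one[OF md, simplified]
  show ?thesis
  proof (rule moduleI)
    show "cring (class_ring :: 'm mod_ring ring)" by (rule class_cring.is_cring)
    show "abelian_group (direct_sum_list Ms)"
    proof (rule abelian_groupI)
      fix x assume x: "x \<in> carrier (direct_sum_list Ms)"
      show "\<exists>y\<in>carrier (direct_sum_list Ms). y \<oplus>\<^bsub>direct_sum_list Ms\<^esub> x = \<zero>\<^bsub>direct_sum_list Ms\<^esub>"
        using x
        by (intro bexI[of _ "map (\<lambda>i. \<ominus>\<^bsub>Ms ! i\<^esub> (x ! i)) [0..<length Ms]"])
          (auto simp: direct_sum_list_def intro!: nth_equalityI abelian_group.l_neg[OF ag] abelian_group.a_inv_closed[OF ag])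
    next
      fix x y assume x: "x \<in> carrier (direct_sum_list Ms)" and y: "y \<in> carrier (direct_sum_list Ms)"
      show "x \<oplus>\<^bsub>direct_sum_list Ms\<^esub> y = y \<oplus>\<^bsub>direct_sum_list Ms\<^esub> x"
        using x y by (auto simp: direct_sum_list_def intro!: abelian_monoid.a_comm[OF abelian_group.axioms(1)[OF ag]])
    qed (auto simp: direct_sum_list_def ax intro!: nth_equalityI)
  qed (auto simp: direct_sum_list_def ax intro!: nth_equalityI)
qed

section \<open>Direct sums along lists\<close>

lemma carrier_direct_sum_Cons:
  "carrier (direct_sum_list (M # Ms)) = (\<lambda>(x, xs). x # xs) ` (carrier M \<times> carrier (direct_sum_list Ms))"
proof (intro equalityI subsetI)
  fix xs assume "xs \<in> carrier (direct_sum_list (M # Ms))"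
  then show "xs \<in> (\<lambda>(x, xs). x # xs) ` (carrier M \<times> carrier (direct_sum_list Ms))"
    by (cases xs) (auto simp: direct_sum_list_def All_less_Suc2 image_iff)
qed (auto simp: direct_sum_list_def All_less_Suc2)

lemma direct_sum_Cons_simps:
  "(x # xs) \<oplus>\<^bsub>direct_sum_list (M # Ms)\<^esub> (y # ys) = (x \<oplus>\<^bsub>M\<^esub> y) # (xs \<oplus>\<^bsub>direct_sum_list Ms\<^esub> ys)"
  "k \<odot>\<^bsub>direct_sum_list (M # Ms)\<^esub> (x # xs) = (k \<odot>\<^bsub>M\<^esub> x) # (k \<odot>\<^bsub>direct_sum_list Ms\<^esub> xs)"
  "\<zero>\<^bsub>direct_sum_list (M # Ms)\<^esub> = \<zero>\<^bsub>M\<^esub> # \<zero>\<^bsub>direct_sum_list Ms\<^esub>"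
  by (auto simp: direct_sum_list_def map_upt_Suc simp del: upt_Suc)

lemma direct_sum_Nil_simps:
  "carrier (direct_sum_list []) = {[]}" "xs \<oplus>\<^bsub>direct_sum_list []\<^esub> ys = []"
  "k \<odot>\<^bsub>direct_sum_list []\<^esub> xs = []" "\<zero>\<^bsub>direct_sum_list []\<^esub> = []"
  by (auto simp: direct_sum_list_def)

lemma carrier_direct_sum_append:
  fixes Ms Ns :: "('r, 'a) module list"
  shows "carrier (direct_sum_list (Ms @ Ns)) =
    (\<lambda>(xs, ys). xs @ ys) ` (carrier (direct_sum_list Ms) \<times> carrier (direct_sum_list Ns))"
proof (induction Ms)
  case Nil
  have "(\<lambda>(xs, ys). xs @ ys) ` ({[]} \<times> A) = A" for A :: "'a list set"
    by (auto simp: image_iff)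
  then show ?case by (simp add: direct_sum_Nil_simps)
next
  case (Cons M Ms)
  have "(\<lambda>(x, xs). x # xs) ` (A \<times> ((\<lambda>(xs, ys). xs @ ys) ` (B \<times> C))) =
    (\<lambda>(xs, ys). xs @ ys) ` (((\<lambda>(x, xs). x # xs) ` (A \<times> B)) \<times> C)" for A and B C :: "'a list set"
    by (intro equalityI subsetI; clarsimp simp: image_iff; metis)
  then show ?case
    unfolding append_Cons carrier_direct_sum_Cons Cons by simp
qed

lemma direct_sum_append_add:
  "xs \<in> carrier (direct_sum_list Ms) \<Longrightarrow> xs' \<in> carrier (direct_sum_list Ms) \<Longrightarrow>
   (xs @ ys) \<oplus>\<^bsub>direct_sum_list (Ms @ Ns)\<^esub> (xs' @ ys') =
   (xs \<oplus>\<^bsub>direct_sum_list Ms\<^esub> xs') @ (ys \<oplus>\<^bsub>direct_sum_list Ns\<^esub> ys')"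
proof (induction Ms arbitrary: xs xs')
  case Nil
  then show ?case by (simp add: direct_sum_list_def)
next
  case (Cons M Ms)
  then show ?case by (auto simp: carrier_direct_sum_Cons direct_sum_Cons_simps)
qed

lemma direct_sum_append_smult:
  "xs \<in> carrier (direct_sum_list Ms) \<Longrightarrow>
   k \<odot>\<^bsub>direct_sum_list (Ms @ Ns)\<^esub> (xs @ ys) =
   (k \<odot>\<^bsub>direct_sum_list Ms\<^esub> xs) @ (k \<odot>\<^bsub>direct_sum_list Ns\<^esub> ys)"
proof (induction Ms arbitrary: xs)
  case Nil
  then show ?case by (simp add: direct_sum_list_def)
next
  case (Cons M Ms)
  then show ?case by (auto simp: carrier_direct_sum_Cons direct_sum_Cons_simps)
qed

text \<open>Replacing one summand by a whole list covers three uses: \<open>Ns = []\<close> deletes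
  a trivial summand, a singleton keeps a summand, and a longer list splits a cyclic summand into its
  primary parts.\<close>

lemma iso_direct_sum_Cons:
  assumes M: "M \<cong>\<^sub>M direct_sum_list Ns" and Ms: "direct_sum_list Ms \<cong>\<^sub>M direct_sum_list Ks"
    and md: "\<And>L. L \<in> set (M # Ms) \<Longrightarrow> Module.module class_ring L"
  shows "direct_sum_list (M # Ms) \<cong>\<^sub>M direct_sum_list (Ns @ Ks)"
proof -
  obtain f where f: "bij_betw f (carrier M) (carrier (direct_sum_list Ns))" "f \<zero>\<^bsub>M\<^esub> = \<zero>\<^bsub>(direct_sum_list Ns)\<^esub>"
    "\<forall>x\<in>carrier M. \<forall>y\<in>carrier M. f (x \<oplus>\<^bsub>M\<^esub> y) = f x \<oplus>\<^bsub>(direct_sum_list Ns)\<^esub> f y"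
    "\<forall>k. \<forall>x\<in>carrier M. f (k \<odot>\<^bsub>M\<^esub> x) = k \<odot>\<^bsub>(direct_sum_list Ns)\<^esub> f x"
    using module_isomorphicE[OF M] by blast
  obtain g where g: "bij_betw g (carrier (direct_sum_list Ms)) (carrier (direct_sum_list Ks))" "g \<zero>\<^bsub>(direct_sum_list Ms)\<^esub> = \<zero>\<^bsub>(direct_sum_list Ks)\<^esub>"
    "\<forall>x\<in>carrier (direct_sum_list Ms). \<forall>y\<in>carrier (direct_sum_list Ms). g (x \<oplus>\<^bsub>(direct_sum_list Ms)\<^esub> y) = g x \<oplus>\<^bsub>(direct_sum_list Ks)\<^esub> g y"
    "\<forall>k. \<forall>x\<in>carrier (direct_sum_list Ms). g (k \<odot>\<^bsub>(direct_sum_list Ms)\<^esub> x) = k \<odot>\<^bsub>(direct_sum_list Ks)\<^esub> g x"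
    using module_isomorphicE[OF Ms] by blast
  have fi: "f x \<in> carrier (direct_sum_list Ns)" if "x \<in> carrier M" for x
    using that f(1) by (auto simp: bij_betw_def)
  have fl: "length (f x) = length Ns" if "x \<in> carrier M" for x
    using fi[OF that] by (simp add: direct_sum_list_def)
  have fin: "f x = f y \<longleftrightarrow> x = y" if "x \<in> carrier M" "y \<in> carrier M" for x y
    using that f(1) by (auto simp: bij_betw_def inj_on_def)
  have gin: "g x = g y \<longleftrightarrow> x = y" if "x \<in> carrier (direct_sum_list Ms)" "y \<in> carrier (direct_sum_list Ms)" for x y
    using that g(1) by (auto simp: bij_betw_def inj_on_def)
  have im: "f ` carrier M = carrier (direct_sum_list Ns)"
     "g ` carrier (direct_sum_list Ms) = carrier (direct_sum_list Ks)"
    using f(1) g(1) by (auto simp: bij_betw_def)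
  let ?h = "\<lambda>xs. f (hd xs) @ g (tl xs)"
  show ?thesis
  proof (rule module_isomorphicI[where f = ?h])
    show "Module.module class_ring (direct_sum_list (M # Ms))"
      using md by (rule module_direct_sum_list)
    show "bij_betw ?h (carrier (direct_sum_list (M # Ms))) (carrier (direct_sum_list (Ns @ Ks)))"
    proof (rule bij_betw_imageI)
      show "inj_on ?h (carrier (direct_sum_list (M # Ms)))"
      proof (rule inj_onI)
        fix u v assume "u \<in> carrier (direct_sum_list (M # Ms))" "v \<in> carrier (direct_sum_list (M # Ms))"
          and eq: "?h u = ?h v"
        then obtain x xs y ys where uv: "u = x # xs" "v = y # ys" "x \<in> carrier M" "y \<in> carrier M"
          "xs \<in> carrier (direct_sum_list Ms)" "ys \<in> carrier (direct_sum_list Ms)"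
          unfolding carrier_direct_sum_Cons by auto
        \<comment> \<open>All values of \<open>f\<close> have the length of \<open>Ns\<close>, so
          equal concatenations are cut at the same place.\<close>
        have "f x = f y \<and> g xs = g ys"
          using eq fl[OF uv(3)] fl[OF uv(4)] by (simp add: uv(1,2))
        then show "u = v" using uv fin gin by simp
      qed
      show "?h ` carrier (direct_sum_list (M # Ms)) = carrier (direct_sum_list (Ns @ Ks))"
      proof (intro equalityI subsetI)
        fix z assume "z \<in> ?h ` carrier (direct_sum_list (M # Ms))"
        then obtain x xs where "x \<in> carrier M" "xs \<in> carrier (direct_sum_list Ms)" "z = f x @ g xs"
          unfolding carrier_direct_sum_Cons by auto
        then show "z \<in> carrier (direct_sum_list (Ns @ Ks))"
          unfolding carrier_direct_sum_append using im by (intro image_eqI[of _ _ "(f x, g xs)"]) auto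
      next
        fix z assume "z \<in> carrier (direct_sum_list (Ns @ Ks))"
        then obtain x xs where x: "x \<in> carrier M" "xs \<in> carrier (direct_sum_list Ms)" "z = f x @ g xs"
          unfolding carrier_direct_sum_append im[symmetric] by auto
        then have "x # xs \<in> carrier (direct_sum_list (M # Ms))"
          unfolding carrier_direct_sum_Cons by auto
        with x show "z \<in> ?h ` carrier (direct_sum_list (M # Ms))"
          by (intro image_eqI[of _ _ "x # xs"]) auto
      qed
    qed
    show "?h \<zero>\<^bsub>direct_sum_list (M # Ms)\<^esub> = \<zero>\<^bsub>direct_sum_list (Ns @ Ks)\<^esub>"
      using f(2) g(2) by (simp add: direct_sum_Cons_simps) (simp add: direct_sum_list_def)
  next
    fix x y assume "x \<in> carrier (direct_sum_list (M # Ms))" "y \<in> carrier (direct_sum_list (M # Ms))"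
    then show "?h (x \<oplus>\<^bsub>direct_sum_list (M # Ms)\<^esub> y) = ?h x \<oplus>\<^bsub>direct_sum_list (Ns @ Ks)\<^esub> ?h y"
      by (auto simp: carrier_direct_sum_Cons direct_sum_Cons_simps direct_sum_append_add f g fi)
  next
    fix k x assume "x \<in> carrier (direct_sum_list (M # Ms))"
    then show "?h (k \<odot>\<^bsub>direct_sum_list (M # Ms)\<^esub> x) = k \<odot>\<^bsub>direct_sum_list (Ns @ Ks)\<^esub> ?h x"
      by (auto simp: carrier_direct_sum_Cons direct_sum_Cons_simps direct_sum_append_smult f g fi)
  qed
qed

lemma iso_direct_sum_concat_map:
  fixes G :: "'c \<Rightarrow> ('m::nontriv mod_ring, 'a) module" and F :: "'c \<Rightarrow> ('m mod_ring, 'b) module list"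
  assumes "\<And>d. d \<in> set ds \<Longrightarrow> G d \<cong>\<^sub>M direct_sum_list (F d)"
  shows "direct_sum_list (map G ds) \<cong>\<^sub>M direct_sum_list (concat (map F ds))"
  using assms
proof (induction ds)
  case Nil
  have "Module.module class_ring (direct_sum_list [] :: ('m mod_ring, 'a list) module)"
    by (rule module_direct_sum_list) simp
  then show ?case
    unfolding list.map concat.simps
    by (rule module_isomorphicI[where f = "\<lambda>_. []"]) (simp_all add: direct_sum_Nil_simps bij_betw_def)
next
  case (Cons d ds)
  have "direct_sum_list (map G ds) \<cong>\<^sub>M direct_sum_list (concat (map F ds))"
    using Cons by simp
  moreover have "G d \<cong>\<^sub>M direct_sum_list (F d)"
    by (rule Cons.prems) simp
  moreover have "Module.module class_ring L" if "L \<in> set (G d # map G ds)" for L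
    using that Cons.prems module_isomorphic_modules(1) by (metis imageE list.set_map list.simps(9))
  ultimately show ?case
    unfolding list.map concat.simps by (intro iso_direct_sum_Cons)
qed

lemma iso_direct_sum_singleton:
  assumes "Module.module class_ring M"
  shows "M \<cong>\<^sub>M direct_sum_list [M]"
proof (rule module_isomorphicI[where f = "\<lambda>x. [x]", OF assms])
  show "bij_betw (\<lambda>x. [x]) (carrier M) (carrier (direct_sum_list [M]))"
    by (rule bij_betw_imageI) (auto simp: inj_on_def carrier_direct_sum_Cons direct_sum_Nil_simps)
qed (simp_all add: direct_sum_Cons_simps direct_sum_Nil_simps)

lemma iso_direct_sum_filter_cyclic:
  assumes "\<And>d. d \<in> set ds \<Longrightarrow> d dvd CARD('m::nontriv)"
  shows "direct_sum_list (map cyclic_module ds) \<cong>\<^sub>M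
    (direct_sum_list (map cyclic_module (filter (\<lambda>d. d \<noteq> 1) ds)) :: ('m mod_ring, int list) module)"
  using assms
proof (induction ds)
  case Nil
  show ?case by (auto intro!: module_isomorphic_refl module_direct_sum_list)
next
  case (Cons d ds)
  have IH: "direct_sum_list (map cyclic_module ds) \<cong>\<^sub>M
      (direct_sum_list (map cyclic_module (filter (\<lambda>d. d \<noteq> 1) ds)) :: ('m mod_ring, int list) module)"
    using Cons by simp
  have md: "Module.module class_ring M"
    if "M \<in> set ((cyclic_module d :: ('m mod_ring, int) module) # map cyclic_module ds)" for M
    using that Cons.prems by (auto intro: module_cyclic_module)
  have mdd: "Module.module class_ring (cyclic_module d :: ('m mod_ring, int) module)"
    using Cons.prems by (intro module_cyclic_module) simp
  show ?case
  proof (cases "d = 1")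
    case True
    from mdd have "(cyclic_module d :: ('m mod_ring, int) module) \<cong>\<^sub>M
        (direct_sum_list [] :: ('m mod_ring, int list) module)"
      by (rule module_isomorphicI[where f = "\<lambda>_. []"])
        (auto simp: True bij_betw_def inj_on_def image_def direct_sum_list_def cyclic_module_def intro: exI[of _ 0])
    then have "direct_sum_list (cyclic_module d # map cyclic_module ds) \<cong>\<^sub>M
        (direct_sum_list ([] @ map cyclic_module (filter (\<lambda>d. d \<noteq> 1) ds)) :: ('m mod_ring, int list) module)"
      using IH by (rule iso_direct_sum_Cons) (rule md)
    then show ?thesis by (simp only: True list.map filter.simps append.simps) simp
  next
    case False
    have "direct_sum_list (cyclic_module d # map cyclic_module ds) \<cong>\<^sub>M
        (direct_sum_list ([cyclic_module d] @ map cyclic_module (filter (\<lambda>d. d \<noteq> 1) ds)) :: ('m mod_ring, int list) module)"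
      using iso_direct_sum_singleton[OF mdd] IH by (rule iso_direct_sum_Cons) (rule md)
    then show ?thesis using False by simp
  qed
qed

lemma card_carrier_direct_sum:
  "card (carrier (direct_sum_list Ms)) = prod_list (map (\<lambda>M. card (carrier M)) Ms)"
proof (induction Ms)
  case Nil
  show ?case by (simp add: direct_sum_list_def)
next
  case (Cons M Ms)
  have "inj_on (\<lambda>(x, xs). x # xs) (carrier M \<times> carrier (direct_sum_list Ms))"
    by (auto simp: inj_on_def)
  then show ?case
    by (simp add: carrier_direct_sum_Cons card_image card_cartesian_product Cons)
qed

lemma card_carrier_direct_sum_cyclic:
  "card (carrier (direct_sum_list (map cyclic_module ds) :: ('m::nontriv mod_ring, int list) module)) = prod_list ds"
  by (simp add: card_carrier_direct_sum o_def) (simp add: cyclic_module_def)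

lemma finite_carrier_direct_sum_cyclic:
  "finite (carrier (direct_sum_list (map cyclic_module ds) :: ('m::nontriv mod_ring, int list) module))"
proof (induction ds)
  case Nil
  show ?case by (simp add: direct_sum_list_def)
next
  case (Cons d ds)
  moreover have "finite (carrier (cyclic_module d :: ('m mod_ring, int) module))"
    by (simp add: cyclic_module_def)
  ultimately show ?case by (simp add: carrier_direct_sum_Cons)
qed

section \<open>Composition length\<close>

lemma cl_mult: "a \<noteq> 0 \<Longrightarrow> b \<noteq> 0 \<Longrightarrow> cl (a * b) = cl a + cl b"
  by (simp add: cl_def prime_factorization_mult)

lemma cl_prod_list: "0 \<notin> set ds \<Longrightarrow> cl (prod_list ds) = (\<Sum>d\<leftarrow>ds. cl d)"
proof (induction ds)
  case Nil
  show ?case by (simp add: cl_def)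
next
  case (Cons d ds)
  then show ?case by (simp add: cl_mult prod_list_zero_iff)
qed

lemma cl_prime_power: "prime p \<Longrightarrow> cl (p ^ k) = k"
  by (simp add: cl_def prime_factorization_prime_power)

lemma cl_eq_sum_multiplicity: "cl d = (\<Sum>p\<in>prime_factors d. multiplicity p d)"
  unfolding cl_def size_multiset_overloaded_eq
  by (intro sum.cong) (auto simp: count_prime_factorization in_prime_factors_iff)

text \<open>Chinese remainder theorem. The residue map is injective, since a difference divisible by
  every prime power of \<open>d\<close> is divisible by \<open>d\<close> but smaller in absolute
  value; surjectivity then follows by counting.\<close>

lemma iso_cyclic_primary:
  assumes d: "d dvd CARD('m::nontriv)"
  shows "(cyclic_module d :: ('m mod_ring, int) module) \<cong>\<^sub>M
    direct_sum_list (map (\<lambda>p. cyclic_module (p ^ multiplicity p d)) (sorted_list_of_set (prime_factors d)))"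
proof -
  have d0: "d \<noteq> 0" using d by (cases "d = 0") auto
  define ps where "ps = sorted_list_of_set (prime_factors d)"
  define q where "q p = int (p ^ multiplicity p d)" for p
  let ?N = "direct_sum_list (map (\<lambda>p. cyclic_module (p ^ multiplicity p d)) ps) :: ('m mod_ring, int list) module"
  let ?M = "cyclic_module d :: ('m mod_ring, int) module"
  have setps: "set ps = prime_factors d" and dps: "distinct ps" by (simp_all add: ps_def)
  have N: "?N = direct_sum_list (map cyclic_module (map (\<lambda>p. p ^ multiplicity p d) ps))"
    by (simp add: o_def)
  have q0: "q p > 0" if "p \<in> set ps" for p
    using that by (auto simp: q_def setps in_prime_factors_iff intro: prime_gt_0_nat)
  have qp: "int p ^ multiplicity p d = q p" for p by (simp add: q_def)
  have qd: "q p dvd int d" for p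
    by (simp add: q_def multiplicity_dvd del: of_nat_power)
  have mm: "a mod int d mod q p = a mod q p" for a p
    using qd by (simp add: mod_mod_cancel)
  define f where "f a = map (\<lambda>p. a mod q p) ps" for a
  have cM: "carrier ?M = {0..<int d}" by (simp add: cyclic_module_def)
  have sub: "f ` carrier ?M \<subseteq> carrier ?N"
    using q0 by (auto simp: f_def direct_sum_list_def cyclic_module_def q_def)
  have "inj_on f (carrier ?M)"
  proof (rule inj_onI)
    fix a b assume a: "a \<in> carrier ?M" and b: "b \<in> carrier ?M" and eq: "f a = f b"
    let ?x = "nat \<bar>a - b\<bar>"
    have "a mod q p = b mod q p" if "p \<in> prime_factors d" for p
      using eq that by (auto simp: f_def setps)
    then have "q p dvd a - b" if "p \<in> prime_factors d" for p
      using that by (simp add: mod_eq_dvd_iff)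
    then have dv: "p ^ multiplicity p d dvd ?x" if "p \<in> prime_factors d" for p
      using that unfolding q_def by (metis dvd_abs_iff int_dvd_int_iff int_nat_eq abs_ge_zero)
    \<comment> \<open>The difference 0 is split off because \<open>multiplicity p 0\<close> is 0,
      which would spoil the comparison of multiplicities.\<close>
    have "d dvd ?x"
    proof (cases "?x = 0")
      case False
      show ?thesis
      proof (rule multiplicity_le_imp_dvd[OF d0])
        fix p :: nat assume p: "prime p"
        show "multiplicity p d \<le> multiplicity p ?x"
        proof (cases "p \<in> prime_factors d")
          case True
          show ?thesis using dv[OF True] False p by (intro multiplicity_geI) auto
        next
          case False
          then have "\<not> p dvd d" using p d0 by (auto simp: in_prime_factors_iff)
          then show ?thesis by (simp add: not_dvd_imp_multiplicity_0)
        qed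
      qed
    qed simp
    moreover have "?x < d" using a b by (auto simp: cM)
    ultimately have "?x = 0" using nat_dvd_not_less by blast
    then show "a = b" by simp
  qed
  moreover have "card (carrier ?N) = d"
  proof -
    have "card (carrier ?N) = prod_list (map (\<lambda>p. p ^ multiplicity p d) ps)"
      unfolding N by (rule card_carrier_direct_sum_cyclic)
    also have "\<dots> = (\<Prod>p\<in>prime_factors d. p ^ multiplicity p d)"
      using dps by (simp add: prod.distinct_set_conv_list[symmetric] setps)
    also have "\<dots> = d" using d0 by (simp add: prod_prime_factors)
    finally show ?thesis .
  qed
  moreover have "finite (carrier ?N)" unfolding N by (rule finite_carrier_direct_sum_cyclic)
  ultimately have "f ` carrier ?M = carrier ?N"
    using sub by (intro card_subset_eq) (simp_all add: card_image cM)
  with \<open>inj_on f (carrier ?M)\<close> have bij: "bij_betw f (carrier ?M) (carrier ?N)"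
    by (rule bij_betw_imageI)
  have "?M \<cong>\<^sub>M ?N"
  proof (rule module_isomorphicI[OF module_cyclic_module[OF d] bij])
    show "f \<zero>\<^bsub>?M\<^esub> = \<zero>\<^bsub>?N\<^esub>"
      by (simp add: f_def direct_sum_list_def cyclic_module_def o_def)
  next
    fix x y
    show "f (x \<oplus>\<^bsub>?M\<^esub> y) = f x \<oplus>\<^bsub>?N\<^esub> f y"
      by (intro nth_equalityI)
        (simp_all add: f_def direct_sum_list_def cyclic_module_def mm mod_add_eq qp)
  next
    fix k x
    show "f (k \<odot>\<^bsub>?M\<^esub> x) = k \<odot>\<^bsub>?N\<^esub> f x"
      by (intro nth_equalityI)
        (simp_all add: f_def direct_sum_list_def cyclic_module_def mm mod_mult_right_eq qp)
  qed
  then show ?thesis unfolding ps_def .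
qed

text \<open>The definition picks the length by \<open>THE\<close>, which demands existence and
  uniqueness. Existence comes from splitting each summand into prime powers. For uniqueness,
  \<open>cl\<close> turns the cardinality, a product of orders, into the sum of exponents of any
  prime power decomposition.\<close>

lemma composition_length_direct_sum_cyclic:
  fixes M :: "('m::nontriv mod_ring, 'a) module"
  assumes M: "M \<cong>\<^sub>M direct_sum_list (map cyclic_module ds)"
    and ds: "\<And>d. d \<in> set ds \<Longrightarrow> d dvd CARD('m)"
  shows "composition_length M = (\<Sum>d\<leftarrow>ds. cl d)"
  unfolding composition_length_def
proof (rule the_equality)
  have card: "card (carrier M) = prod_list ds"
    using module_isomorphic_card[OF M] by (simp only: card_carrier_direct_sum_cyclic)
  have ds0: "0 \<notin> set ds" using ds by force
  define pk where "pk d = map (\<lambda>p. (p, multiplicity p d)) (sorted_list_of_set (prime_factors d))" for d :: nat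
  show "\<exists>pks :: (nat \<times> nat) list.
     (\<forall>(p, k)\<in>set pks. prime p \<and> 1 \<le> k \<and> p ^ k dvd CARD('m)) \<and>
     M \<cong>\<^sub>M direct_sum_list (map (\<lambda>(p, k). cyclic_module (p ^ k)) pks) \<and>
     (\<Sum>d\<leftarrow>ds. cl d) = sum_list (map snd pks)"
  proof (intro exI conjI)
    let ?pks = "concat (map pk ds)"
    show "\<forall>(p, k)\<in>set ?pks. prime p \<and> 1 \<le> k \<and> p ^ k dvd CARD('m)"
    proof clarify
      fix p k assume "(p, k) \<in> set ?pks"
      then obtain d where d: "d \<in> set ds" "p \<in> prime_factors d" "k = multiplicity p d"
        by (auto simp: pk_def)
      then have "prime p" "p dvd d" "d \<noteq> 0" by (auto simp: in_prime_factors_iff)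
      moreover from this have "1 \<le> k" using d(3) by (simp add: Suc_le_eq prime_multiplicity_gt_zero_iff)
      moreover have "p ^ k dvd CARD('m)"
        using multiplicity_dvd[of p d] ds[OF d(1)] d(3) dvd_trans by blast
      ultimately show "prime p \<and> 1 \<le> k \<and> p ^ k dvd CARD('m)" by blast
    qed
    let ?F = "\<lambda>d. map (\<lambda>(p, k). cyclic_module (p ^ k)) (pk d) :: ('m mod_ring, int) module list"
    have "(cyclic_module d :: ('m mod_ring, int) module) \<cong>\<^sub>M direct_sum_list (?F d)" if "d \<in> set ds" for d
      using iso_cyclic_primary[OF ds[OF that]] by (simp add: pk_def o_def)
    then have "(direct_sum_list (map cyclic_module ds) :: ('m mod_ring, int list) module) \<cong>\<^sub>M
        direct_sum_list (concat (map ?F ds))"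
      by (rule iso_direct_sum_concat_map)
    moreover have "concat (map ?F ds) = map (\<lambda>(p, k). cyclic_module (p ^ k)) ?pks"
      by (simp add: map_concat o_def)
    ultimately show "M \<cong>\<^sub>M direct_sum_list (map (\<lambda>(p, k). cyclic_module (p ^ k)) ?pks)"
      using module_isomorphic_trans[OF M] by simp
    have "sum_list (map snd (pk d)) = cl d" for d
      by (simp add: pk_def o_def cl_eq_sum_multiplicity sum.distinct_set_conv_list[symmetric])
    then show "(\<Sum>d\<leftarrow>ds. cl d) = sum_list (map snd ?pks)"
      by (induction ds) simp_all
  qed
  fix l assume "\<exists>pks :: (nat \<times> nat) list.
     (\<forall>(p, k)\<in>set pks. prime p \<and> 1 \<le> k \<and> p ^ k dvd CARD('m)) \<and>
     M \<cong>\<^sub>M direct_sum_list (map (\<lambda>(p, k). cyclic_module (p ^ k)) pks) \<and>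
     l = sum_list (map snd pks)"
  then obtain pks :: "(nat \<times> nat) list" where
    pr: "\<forall>(p, k)\<in>set pks. prime p \<and> 1 \<le> k \<and> p ^ k dvd CARD('m)" and
    iso: "M \<cong>\<^sub>M direct_sum_list (map (\<lambda>(p, k). cyclic_module (p ^ k)) pks)" and
    l: "l = sum_list (map snd pks)" by blast
  let ?qs = "map (\<lambda>(p, k). p ^ k) pks"
  have "map (\<lambda>(p, k). cyclic_module (p ^ k)) pks = (map cyclic_module ?qs :: ('m mod_ring, int) module list)"
    by auto
  then have "card (carrier M) = prod_list ?qs"
    using module_isomorphic_card[OF iso] by (simp only: card_carrier_direct_sum_cyclic)
  moreover have "cl (prod_list ?qs) = (\<Sum>q\<leftarrow>?qs. cl q)"
    using pr by (intro cl_prod_list) (auto dest!: bspec)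
  moreover have "(\<Sum>q\<leftarrow>?qs. cl q) = l"
    unfolding l using pr by (induction pks) (auto simp: cl_prime_power)
  ultimately show "l = (\<Sum>d\<leftarrow>ds. cl d)"
    using card cl_prod_list[OF ds0] by simp
qed

section \<open>The incidence system in Smith coordinates\<close>

text \<open>It suffices to make \<open>a + t * s\<close> nonzero modulo every prime divisor p of m.
  If p divides \<open>a\<close>, it does not divide \<open>s\<close>, so \<open>t\<close> must be
  nonzero modulo p; if p does not divide \<open>a\<close>, a multiple \<open>t\<close> of p changes
  nothing.\<close>

lemma mod_ring_stable_range:
  fixes a s :: "'m::nontriv mod_ring"
  assumes "a * q + s = 1"
  obtains t v where "(a + t * s) * v = 1"
proof -
  define A S M where "A = to_int_mod_ring a" and "S = to_int_mod_ring s" and "M = int CARD('m)"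
  \<comment> \<open>The product of the primes of m that do not divide \<open>A\<close> meets both
    demands at once.\<close>
  define T where "T = \<Prod>{p \<in> prime_factors M. \<not> p dvd A}"
  have M0: "M \<noteq> 0" by (simp add: M_def)
  have "of_int (A * to_int_mod_ring q + S - 1) = (0 :: 'm mod_ring)"
    using assms by (simp add: A_def S_def of_int_to_int_mod_ring)
  then have MQ: "M dvd A * to_int_mod_ring q + S - 1"
    by (simp only: of_int_mod_ring_eq_0_iff M_def)
  have "coprime (A + T * S) M"
  proof (rule ccontr)
    assume "\<not> coprime (A + T * S) M"
    then have "\<not> is_unit (gcd (A + T * S) M)" by (simp add: coprime_iff_gcd_eq_1)
    then obtain p where p: "prime p" "p dvd A + T * S" "p dvd M"
      using prime_divisor_exists[of "gcd (A + T * S) M"] M0 by auto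
    have pM: "p \<in> prime_factors M" using p M0 by (simp add: in_prime_factors_iff)
    show False
    proof (cases "p dvd A")
      case True
      then have "p dvd T * S" using p(2) by (simp add: dvd_add_right_iff)
      moreover have "\<not> p dvd T"
      proof
        assume "p dvd T"
        then obtain r where "r \<in> prime_factors M" "\<not> r dvd A" "p dvd r"
          using p(1) unfolding T_def by (auto simp: prime_dvd_prod_iff)
        then show False using p(1) True primes_dvd_imp_eq[of p r] by auto
      qed
      moreover have "\<not> p dvd S"
      proof
        assume "p dvd S"
        then have "p dvd A * to_int_mod_ring q + S" using True by simp
        moreover have "p dvd A * to_int_mod_ring q + S - 1" using p(3) MQ by (rule dvd_trans)
        ultimately have "p dvd 1" by (metis dvd_diff_right_iff)
        then show False using p(1) not_prime_unit by blast
      qed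
      ultimately show False using p(1) prime_dvd_mult_iff by blast
    next
      case False
      then have "p dvd T" unfolding T_def using pM by (intro dvd_prodI) auto
      then have "p dvd A" using p(2) by (simp add: dvd_add_left_iff)
      with False show False by simp
    qed
  qed
  then obtain x where "[(A + T * S) * x = 1] (mod M)"
    using cong_solve_coprime_int by blast
  then have "M dvd (A + T * S) * x - 1"
    by (simp add: cong_iff_dvd_diff)
  then have "of_int ((A + T * S) * x - 1) = (0 :: 'm mod_ring)"
    unfolding of_int_mod_ring_eq_0_iff M_def .
  then have "(a + of_int T * s) * of_int x = 1"
    by (simp add: A_def S_def of_int_to_int_mod_ring)
  then show thesis by (rule that)
qed

text \<open>The kernel of a diagonal matrix over Z_m. An entry 1 forces the coordinate to be 0, and
  an entry m imposes no condition, so free coordinates are encoded by m.\<close>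

definition annihilated_module :: "nat list \<Rightarrow> ('m::nontriv mod_ring, 'm mod_ring vec) module" where
  "annihilated_module ds = (module_vec TYPE('m mod_ring) (length ds))
     \<lparr>carrier := {x \<in> carrier_vec (length ds). \<forall>i<length ds. of_nat (ds ! i) * x $ i = 0}\<rparr>"

lemma to_int_mod_ring_annihilated:
  fixes a :: "'m::nontriv mod_ring"
  assumes d: "d dvd CARD('m)" and a: "of_nat d * a = 0"
  shows "int (CARD('m) div d) dvd to_int_mod_ring a"
proof -
  have "of_int (int d * to_int_mod_ring a) = (0 :: 'm mod_ring)"
    using a by (simp add: of_int_to_int_mod_ring)
  then have "int CARD('m) dvd int d * to_int_mod_ring a"
    by (simp only: of_int_mod_ring_eq_0_iff)
  moreover have "int CARD('m) = int d * int (CARD('m) div d)"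
    using d by (metis dvd_mult_div_cancel of_nat_mult)
  moreover have "int d \<noteq> 0" using d by (cases "d = 0") auto
  ultimately show ?thesis by (metis dvd_mult_cancel_left)
qed

text \<open>The annihilator of a divisor d in Z_m consists of the multiples of m / d, and division
  by m / d identifies it with Z_d. The module axioms enter as a hypothesis because they are
  transported from the solution module.\<close>

lemma annihilated_module_isomorphic:
  assumes ds: "\<And>d. d \<in> set ds \<Longrightarrow> d dvd CARD('m::nontriv)"
    and md: "Module.module class_ring (annihilated_module ds :: ('m mod_ring, 'm mod_ring vec) module)"
  shows "(annihilated_module ds :: ('m mod_ring, 'm mod_ring vec) module) \<cong>\<^sub>M
    direct_sum_list (map cyclic_module ds)"
proof -
  let ?M = "annihilated_module ds :: ('m mod_ring, 'm mod_ring vec) module"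
  let ?N = "direct_sum_list (map cyclic_module ds) :: ('m mod_ring, int list) module"
  define l where "l = length ds"
  define c where "c i = int (CARD('m) div ds ! i)" for i
  have dm: "int CARD('m) = c i * int (ds ! i)" if "i < l" for i
    using ds[of "ds ! i"] that unfolding c_def l_def
    by (metis dvd_div_mult_self nth_mem of_nat_mult)
  have c0: "c i > 0" and d0: "ds ! i > 0" if "i < l" for i
    using dm[OF that] by (auto simp: c_def intro: ccontr[of "_ > 0"])
  have cM: "carrier ?M = {x \<in> carrier_vec l. \<forall>i<l. of_nat (ds ! i) * x $ i = 0}"
    by (simp add: annihilated_module_def l_def)
  have dvd: "c i dvd to_int_mod_ring (x $ i)" if "x \<in> carrier ?M" "i < l" for x i
    unfolding c_def using that by (intro to_int_mod_ring_annihilated ds) (auto simp: cM l_def)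
  have cN: "carrier ?N = {xs. length xs = l \<and> (\<forall>i<l. 0 \<le> xs ! i \<and> xs ! i < int (ds ! i))}"
    by (auto simp: direct_sum_list_def cyclic_module_def l_def)
  define f where "f x = map (\<lambda>i. to_int_mod_ring (x $ i) div c i) [0..<l]" for x :: "'m mod_ring vec"
  define g where "g xs = vec l (\<lambda>i. of_int (c i * xs ! i) :: 'm mod_ring)" for xs
  show ?thesis
  proof (rule module_isomorphicI[OF md])
    show "bij_betw f (carrier ?M) (carrier ?N)"
    proof (rule bij_betw_byWitness[where f' = g])
      show "\<forall>x\<in>carrier ?M. g (f x) = x"
      proof
        fix x assume x: "x \<in> carrier ?M"
        show "g (f x) = x"
          using x dvd[OF x]
          by (intro eq_vecI) (auto simp: g_def f_def cM of_int_to_int_mod_ring simp del: of_int_mult)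
      qed
      show "\<forall>xs\<in>carrier ?N. f (g xs) = xs"
      proof
        fix xs assume xs: "xs \<in> carrier ?N"
        have "to_int_mod_ring (of_int (c i * xs ! i) :: 'm mod_ring) = c i * xs ! i" if "i < l" for i
          unfolding of_int_of_int_mod_ring using xs that c0[OF that] dm[OF that]
          by (intro to_int_mod_ring_of_int_mod_ring) (auto simp: cN)
        then show "f (g xs) = xs"
          using xs c0[THEN less_imp_neq] by (intro nth_equalityI) (auto simp: f_def g_def cN simp del: of_int_mult)
      qed
      show "f ` carrier ?M \<subseteq> carrier ?N"
      proof clarify
        fix x assume x: "x \<in> carrier ?M"
        have "to_int_mod_ring (x $ i) div c i < int (ds ! i)" if i: "i < l" for i
        proof -
          obtain a where a: "to_int_mod_ring (x $ i) = c i * a" using dvd[OF x i] by (rule dvdE)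
          then have "c i * a < c i * int (ds ! i)"
            using to_int_mod_ring_range(2)[of "x $ i"] dm[OF i] by simp
          then show ?thesis using c0[OF i] a by simp
        qed
        moreover have "0 \<le> to_int_mod_ring (x $ i) div c i" if "i < l" for i
          using to_int_mod_ring_range(1)[of "x $ i"] c0[OF that] by (simp add: pos_imp_zdiv_nonneg_iff)
        ultimately show "f x \<in> carrier ?N" by (simp add: f_def cN)
      qed
      show "g ` carrier ?N \<subseteq> carrier ?M"
      proof clarify
        fix xs
        have "of_nat (ds ! i) * of_int (c i * xs ! i) = (0 :: 'm mod_ring)" if "i < l" for i
        proof -
          have "of_int (int (ds ! i) * (c i * xs ! i)) = (0 :: 'm mod_ring)"
            unfolding of_int_mod_ring_eq_0_iff dm[OF that] by simp
          then show ?thesis by simp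
        qed
        then show "g xs \<in> carrier ?M" by (simp add: g_def cM)
      qed
    qed
    show "f \<zero>\<^bsub>?M\<^esub> = \<zero>\<^bsub>?N\<^esub>"
      by (intro nth_equalityI)
        (simp_all add: f_def annihilated_module_def direct_sum_list_def cyclic_module_def module_vec_simps l_def)
  next
    fix x y assume x: "x \<in> carrier ?M" and y: "y \<in> carrier ?M"
    have "to_int_mod_ring (x $ i + y $ i) div c i =
      (to_int_mod_ring (x $ i) div c i + to_int_mod_ring (y $ i) div c i) mod int (ds ! i)" if i: "i < l" for i
    proof -
      \<comment> \<open>Since m is \<open>c i * int (ds ! i)\<close>, reducing
        \<open>c i * (a + b)\<close> modulo m and dividing by \<open>c i\<close> amounts to reducing
        \<open>a + b\<close> modulo \<open>ds ! i\<close>.\<close>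
      obtain a b where "to_int_mod_ring (x $ i) = c i * a" "to_int_mod_ring (y $ i) = c i * b"
        using dvd[OF x i] dvd[OF y i] by (auto elim!: dvdE)
      then show ?thesis
        using c0[OF i] by (simp add: to_int_mod_ring_add dm[OF i] distrib_left[symmetric] mult_mod_right[symmetric])
    qed
    then show "f (x \<oplus>\<^bsub>?M\<^esub> y) = f x \<oplus>\<^bsub>?N\<^esub> f y"
      using x y by (intro nth_equalityI)
        (auto simp: f_def annihilated_module_def direct_sum_list_def cyclic_module_def module_vec_simps l_def)
  next
    fix k x assume x: "x \<in> carrier ?M"
    have "to_int_mod_ring (k * x $ i) div c i =
      (to_int_mod_ring k * (to_int_mod_ring (x $ i) div c i)) mod int (ds ! i)" if i: "i < l" for i
    proof -
      obtain a where "to_int_mod_ring (x $ i) = c i * a"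
        using dvd[OF x i] by (auto elim!: dvdE)
      then show ?thesis
        using c0[OF i] by (simp add: to_int_mod_ring_mult dm[OF i] mult.left_commute[of _ "c i"] mult_mod_right[symmetric])
    qed
    then show "f (k \<odot>\<^bsub>?M\<^esub> x) = k \<odot>\<^bsub>?N\<^esub> f x"
      using x by (intro nth_equalityI)
        (auto simp: f_def annihilated_module_def direct_sum_list_def cyclic_module_def module_vec_simps l_def)
  qed
qed

section \<open>Linear systems over Z_m and their Smith normal forms\<close>

lemma mult_mat_vec_smult:
  fixes A :: "'a::comm_ring_1 mat"
  assumes "A \<in> carrier_mat nr nc" "v \<in> carrier_vec nc"
  shows "A *\<^sub>v (k \<cdot>\<^sub>v v) = k \<cdot>\<^sub>v (A *\<^sub>v v)"
  using assms by (intro eq_vecI) auto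

lemma mult_mat_vec_zero:
  fixes A :: "'a::comm_ring_1 mat"
  assumes "A \<in> carrier_mat nr nc"
  shows "A *\<^sub>v 0\<^sub>v nc = 0\<^sub>v nr"
  using assms by (intro eq_vecI) auto

lemma module_PS0:
  fixes B :: "'m::nontriv mod_ring mat"
  assumes B: "B \<in> carrier_mat k n" and n: "0 < n"
  shows "Module.module class_ring (PS0_module n B)"
proof (rule moduleI)
  show "cring (class_ring :: 'm mod_ring ring)" by (rule class_cring.is_cring)
  have add: "x + y \<in> PS0 n B" if "x \<in> PS0 n B" "y \<in> PS0 n B" for x y
    using that B n by (auto simp: PS0_def mult_add_distrib_mat_vec[OF B])
  have smult: "c \<cdot>\<^sub>v x \<in> PS0 n B" if "x \<in> PS0 n B" for c x
    using that B n by (auto simp: PS0_def mult_mat_vec_smult[OF B])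
  show "abelian_group (PS0_module n B)"
  proof (rule abelian_groupI)
    fix x assume x: "x \<in> carrier (PS0_module n B)"
    have "(-1) \<cdot>\<^sub>v x \<in> PS0 n B" using x smult by (simp add: PS0_module_def)
    moreover have "(-1) \<cdot>\<^sub>v x + x = 0\<^sub>v n"
      using x by (intro eq_vecI) (auto simp: PS0_module_def PS0_def)
    ultimately show "\<exists>y\<in>carrier (PS0_module n B). y \<oplus>\<^bsub>PS0_module n B\<^esub> x = \<zero>\<^bsub>PS0_module n B\<^esub>"
      by (auto simp: PS0_module_def module_vec_simps)
  next
    show "\<zero>\<^bsub>PS0_module n B\<^esub> \<in> carrier (PS0_module n B)"
      using B n by (auto simp: PS0_module_def PS0_def module_vec_simps)
  qed (use add in \<open>auto simp: PS0_module_def PS0_def module_vec_simps comm_add_vec\<close>)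
qed (use B n in \<open>auto simp: PS0_module_def PS0_def module_vec_simps mult_mat_vec_smult[OF B]
    add_smult_distrib_vec smult_add_distrib_vec smult_smult_assoc\<close>)

lemma smith_form_mult_vec:
  fixes S :: "'m::nontriv mod_ring mat"
  assumes S: "smith_form S ds" "S \<in> carrier_mat k n" and z: "z \<in> carrier_vec n"
  shows "S *\<^sub>v z = 0\<^sub>v k \<longleftrightarrow> (\<forall>i<length ds. of_nat (ds ! i) * z $ i = 0)"
proof -
  have le: "length ds \<le> k" "length ds \<le> n"
    and entries: "\<forall>i<k. \<forall>j<n. S $$ (i, j) = (if i = j \<and> i < length ds then of_nat (ds ! i) else 0)"
    using S by (auto simp: smith_form_def)
  have "(S *\<^sub>v z) $ i = (if i < length ds then of_nat (ds ! i) * z $ i else 0)" if "i < k" for i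
  proof -
    have "(S *\<^sub>v z) $ i = (\<Sum>j = 0..<n. S $$ (i, j) * z $ j)"
      using S z that by (auto simp: scalar_prod_def intro!: sum.cong)
    also have "\<dots> = (\<Sum>j = 0..<n. if j = i then (if i < length ds then of_nat (ds ! i) * z $ i else 0) else 0)"
      using entries that by (intro sum.cong) auto
    also have "\<dots> = (if i < length ds then of_nat (ds ! i) * z $ i else 0)"
      using le by (simp add: sum.delta)
    finally show ?thesis .
  qed
  moreover have "S *\<^sub>v z = 0\<^sub>v k \<longleftrightarrow> (\<forall>i<k. (S *\<^sub>v z) $ i = 0)"
    using S(2) by (auto simp: vec_eq_iff)
  ultimately show ?thesis using le(1) by auto
qed

text \<open>The dimensions of the inverse are read off from the column counts of the two product
  equations.\<close>

lemma invertible_matE: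
  assumes "invertible_mat A" "A \<in> carrier_mat n n"
  obtains A' where "A' \<in> carrier_mat n n" "A * A' = 1\<^sub>m n" "A' * A = 1\<^sub>m n"
proof -
  obtain A' where A': "A * A' = 1\<^sub>m (dim_row A)" "A' * A = 1\<^sub>m (dim_row A')"
    using assms by (auto simp: invertible_mat_def inverts_mat_def)
  have "dim_col A' = n" using arg_cong[OF A'(1), of dim_col] assms(2) by simp
  moreover have "dim_row A' = n" using arg_cong[OF A'(2), of dim_col] assms(2) by simp
  ultimately show thesis using A' assms(2) by (intro that[of A']) auto
qed

text \<open>The all-ones vector lies in the kernel of \<open>B\<close>, and the coordinate functional \<open>y $ 0\<close> takes
  the value 1 on it. In Smith coordinates \<open>z = Q'y\<close> the same vector \<open>w\<close> admits a second functional
  \<open>lam\<close> with \<open>lam w = 1\<close> that, by stable range, involves the last (free) coordinate with a unit.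
  Both kernels are complements of the line through \<open>w\<close>, hence isomorphic by projection along it.\<close>

lemma PS0_module_isomorphic:
  fixes B :: "'m::nontriv mod_ring mat"
  assumes B: "B \<in> carrier_mat k n" and n: "0 < n"
    and ones: "B *\<^sub>v vec n (\<lambda>_. 1) = 0\<^sub>v k"
    and smith: "has_smith_normal_form B ds"
  shows "length ds < n"
    and "PS0_module n B \<cong>\<^sub>M
      direct_sum_list (map cyclic_module (ds @ replicate (n - 1 - length ds) CARD('m)))"
proof -
  obtain P Q where P: "P \<in> carrier_mat k k" "invertible_mat P"
    and Q: "Q \<in> carrier_mat n n" "invertible_mat Q" and S: "smith_form (P * B * Q) ds"
    using smith B by (auto simp: has_smith_normal_form_def)
  obtain P' where P': "P' \<in> carrier_mat k k" "P' * P = 1\<^sub>m k"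
    using P by (elim invertible_matE) auto
  obtain Q' where Q': "Q' \<in> carrier_mat n n" "Q * Q' = 1\<^sub>m n" "Q' * Q = 1\<^sub>m n"
    using Q by (elim invertible_matE) auto
  have PBQ: "P * B * Q \<in> carrier_mat k n" using P B Q by auto
  have QQ': "Q *\<^sub>v (Q' *\<^sub>v y) = y" and Q'Q: "Q' *\<^sub>v (Q *\<^sub>v y) = y" if "y \<in> carrier_vec n" for y
    using that Q Q' by (metis assoc_mult_mat_vec one_mult_mat_vec)+
  have Sz: "(P * B * Q) *\<^sub>v z = P *\<^sub>v (B *\<^sub>v (Q *\<^sub>v z))" if "z \<in> carrier_vec n" for z
    using that P B Q by (simp add: assoc_mult_mat_vec[of _ k n _ n] assoc_mult_mat_vec[of _ k k _ n])
  have kerB: "B *\<^sub>v (Q *\<^sub>v z) = 0\<^sub>v k \<longleftrightarrow> (\<forall>i<length ds. of_nat (ds ! i) * z $ i = 0)"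
    if z: "z \<in> carrier_vec n" for z
  proof -
    have c: "B *\<^sub>v (Q *\<^sub>v z) \<in> carrier_vec k" using z B Q by auto
    have "P' *\<^sub>v (P *\<^sub>v (B *\<^sub>v (Q *\<^sub>v z))) = B *\<^sub>v (Q *\<^sub>v z)"
      using c P P' by (metis assoc_mult_mat_vec one_mult_mat_vec)
    then have "B *\<^sub>v (Q *\<^sub>v z) = 0\<^sub>v k \<longleftrightarrow> P *\<^sub>v (B *\<^sub>v (Q *\<^sub>v z)) = 0\<^sub>v k"
      using P P' by (metis mult_mat_vec_zero)
    then show ?thesis
      using smith_form_mult_vec[OF S PBQ z] by (simp add: Sz[OF z])
  qed
  define u where "u = vec n (\<lambda>_. 1 :: 'm mod_ring)"
  define w where "w = Q' *\<^sub>v u"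
  have u: "u \<in> carrier_vec n" and w: "w \<in> carrier_vec n" and Qw: "Q *\<^sub>v w = u"
    using Q' by (auto simp: u_def w_def QQ')
  have dw: "of_nat (ds ! i) * w $ i = 0" if "i < length ds" for i
    using kerB[OF w] ones that by (simp add: Qw u_def)
  have ds: "1 \<le> ds ! i" "ds ! i \<le> CARD('m) - 1" "ds ! i dvd CARD('m)" if "i < length ds" for i
    using S that by (auto simp: smith_form_def)
  have "length ds \<le> n" using S Q by (simp add: smith_form_def)
  \<comment> \<open>If there were n divisors, the last one, \<open>d\<close>, would be a multiple of
    all others and so annihilate \<open>w\<close> and its image \<open>u\<close> under
    \<open>Q\<close>. An entry 1 of \<open>u\<close> then gives d = 0 in Z_m, against 1 \<le> d
    \<le> m - 1.\<close>
  moreover have "length ds \<noteq> n"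
  proof
    assume len: "length ds = n"
    have chain: "ds ! i dvd ds ! j" if "i \<le> j" "j < n" for i j
      using that
    proof (induction j)
      case (Suc j)
      have "ds ! j dvd ds ! Suc j" using S Suc.prems len by (simp add: smith_form_def)
      then show ?case using Suc by (cases "i = Suc j") (auto intro: dvd_trans)
    qed simp
    define d where "d = ds ! (n - 1)"
    have "of_nat d \<cdot>\<^sub>v w = 0\<^sub>v n"
    proof (rule eq_vecI)
      fix i assume i: "i < dim_vec (0\<^sub>v n :: 'm mod_ring vec)"
      then have "ds ! i dvd d" unfolding d_def by (intro chain) auto
      then obtain e where "d = ds ! i * e" by (rule dvdE)
      then show "(of_nat d \<cdot>\<^sub>v w) $ i = 0\<^sub>v n $ i"
        using i w dw[of i] len by (simp add: mult_ac)
    qed (use w in auto)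
    then have "of_nat d \<cdot>\<^sub>v u = 0\<^sub>v n"
      using mult_mat_vec_smult[OF Q(1) w, of "of_nat d"] Q by (simp add: Qw mult_mat_vec_zero)
    then have "(of_nat d \<cdot>\<^sub>v u) $ 0 = 0" using n by simp
    then have "of_int (int d) = (0 :: 'm mod_ring)" using n by (simp add: u_def)
    then have "CARD('m) dvd d" unfolding of_int_mod_ring_eq_0_iff by simp
    moreover have "0 < d" "d < CARD('m)" using ds[of "n - 1"] n len by (auto simp: d_def)
    ultimately show False by (simp add: nat_dvd_not_less)
  qed
  ultimately show rn: "length ds < n" by simp
  define l where "l = n - 1"
  have nl: "n = Suc l" using n by (simp add: l_def)
  \<comment> \<open>The last coordinate, with index \<open>l\<close>, is left out: it is the free
    one that is cancelled against the line through \<open>w\<close>. The other free coordinates get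
    the divisor m, a vacuous condition.\<close>
  define D where "D = ds @ replicate (l - length ds) CARD('m)"
  have lenD: "length D = l" using rn by (simp add: D_def nl)
  have Ddvd: "d dvd CARD('m)" if "d \<in> set D" for d
    using that ds by (auto simp: D_def in_set_conv_nth)
  have kerD: "B *\<^sub>v (Q *\<^sub>v z) = 0\<^sub>v k \<longleftrightarrow> (\<forall>i<l. of_nat (D ! i) * z $ i = 0)"
    if z: "z \<in> carrier_vec n" for z
    unfolding kerB[OF z] using rn by (auto simp: D_def nth_append nl)
  \<comment> \<open>The functional \<open>y $ 0\<close> in Smith coordinates is the top row of
    \<open>Q\<close>; \<open>psi\<close> is its part without the last coordinate.\<close>
  define q where "q j = Q $$ (0, j)" for j
  define psi where "psi z = (\<Sum>j<l. q j * z $ j)" for z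
  have phi: "(Q *\<^sub>v z) $ 0 = psi z + q l * z $ l" if z: "z \<in> carrier_vec n" for z
  proof -
    have "(Q *\<^sub>v z) $ 0 = (\<Sum>j<n. q j * z $ j)"
      using Q z n by (auto simp: scalar_prod_def q_def lessThan_atLeast0 intro!: sum.cong)
    then show ?thesis by (simp add: nl psi_def)
  qed
  \<comment> \<open>This is \<open>u $ 0 = 1\<close>, written in the form that stable range
    requires.\<close>
  have "w $ l * q l + psi w = 1"
    using phi[OF w] n by (simp add: Qw u_def mult.commute add.commute)
  then obtain t v where tv: "(w $ l + t * psi w) * v = 1"
    by (rule mod_ring_stable_range)
  \<comment> \<open>The unit \<open>v\<close> normalizes \<open>lam w\<close> to 1 and is also the
    coefficient of the last coordinate, so the kernel of \<open>lam\<close> is the graph of a linear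
    function of the first \<open>l\<close> coordinates.\<close>
  define lam where "lam z = (z $ l + t * psi z) * v" for z
  have psi_add: "psi (x + y) = psi x + psi y" and psi_smult: "psi (c \<cdot>\<^sub>v x) = c * psi x"
    and psi_minus: "psi (x - y) = psi x - psi y"
    if "x \<in> carrier_vec n" "y \<in> carrier_vec n" for x y c
    using that by (simp_all add: psi_def nl sum.distrib sum_distrib_left sum_subtractf algebra_simps)
  have lam_add: "lam (x + y) = lam x + lam y" and lam_smult: "lam (c \<cdot>\<^sub>v x) = c * lam x"
    and lam_minus: "lam (x - y) = lam x - lam y"
    if "x \<in> carrier_vec n" "y \<in> carrier_vec n" for x y c
    using that by (simp_all add: lam_def psi_add[OF that] psi_minus[OF that] psi_smult[OF that] nl algebra_simps)
  have lam_w: "lam w = 1" using tv by (simp add: lam_def)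
  have proj0: "lam (z - lam z \<cdot>\<^sub>v w) = 0" if z: "z \<in> carrier_vec n" for z
    using lam_minus[OF z smult_carrier_vec[THEN iffD2, OF w]] lam_smult[OF w w] lam_w by simp
  have lam0: "z $ l = - t * psi z" if "lam z = 0" for z
  proof -
    \<comment> \<open>The factor \<open>v\<close> is cancelled with its inverse
      \<open>w $ l + t * psi w\<close>.\<close>
    have "(z $ l + t * psi z) * (v * (w $ l + t * psi w)) = 0"
      using that by (simp add: lam_def mult.assoc[symmetric])
    then show ?thesis using tv by (simp add: mult.commute eq_neg_iff_add_eq_0)
  qed
  \<comment> \<open>\<open>g\<close> moves along \<open>w\<close> into the kernel of
    \<open>lam\<close> and forgets the last coordinate. Its inverse \<open>h\<close> restores that
    coordinate by \<open>lift\<close> and moves along \<open>u\<close> back to the vectors with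
    \<open>y $ 0 = 0\<close>.\<close>
  define g where "g y = vec l (\<lambda>i. (Q' *\<^sub>v y - lam (Q' *\<^sub>v y) \<cdot>\<^sub>v w) $ i)" for y
  define lift where "lift x = vec n (\<lambda>i. if i < l then x $ i else - t * (\<Sum>j<l. q j * x $ j))"
    for x :: "'m mod_ring vec"
  define h where "h x = Q *\<^sub>v lift x - (Q *\<^sub>v lift x) $ 0 \<cdot>\<^sub>v u" for x
  have lift: "lift x \<in> carrier_vec n" for x by (simp add: lift_def)
  have lam_lift: "lam (lift x) = 0" for x
  proof -
    have "psi (lift x) = (\<Sum>j<l. q j * x $ j)" by (simp add: psi_def lift_def nl)
    then show ?thesis by (simp add: lam_def) (simp add: lift_def nl)
  qed
  have lift_trunc: "lift (vec l (\<lambda>i. z $ i)) = z" if "z \<in> carrier_vec n" "lam z = 0" for z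
    using that lam0[OF that(2)] by (intro eq_vecI) (auto simp: lift_def nl psi_def less_Suc_eq)
  let ?T = "annihilated_module D :: ('m mod_ring, 'm mod_ring vec) module"
  have cT: "carrier ?T = {x \<in> carrier_vec l. \<forall>i<l. of_nat (D ! i) * x $ i = 0}"
    by (simp add: annihilated_module_def lenD)
  have Q'c: "Q' *\<^sub>v y \<in> carrier_vec n" if "y \<in> carrier_vec n" for y using that Q' by auto
  have PS0D: "y \<in> carrier_vec n" "y $ 0 = 0" "\<forall>i<l. of_nat (D ! i) * (Q' *\<^sub>v y) $ i = 0"
    if "y \<in> PS0 n B" for y
    using that B kerD[of "Q' *\<^sub>v y"] Q' by (auto simp: PS0_def QQ')
  have Dw: "\<forall>i<l. of_nat (D ! i) * w $ i = 0"
    using kerD[OF w] ones by (simp add: Qw u_def)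
  have "PS0_module n B \<cong>\<^sub>M ?T"
  proof (rule module_isomorphicI[OF module_PS0[OF B n]])
    show "bij_betw g (carrier (PS0_module n B)) (carrier ?T)"
    proof (rule bij_betw_byWitness[where f' = h])
      show "\<forall>y\<in>carrier (PS0_module n B). h (g y) = y"
      proof
        fix y assume "y \<in> carrier (PS0_module n B)"
        then have y: "y \<in> PS0 n B" by (simp add: PS0_module_def)
        let ?c = "lam (Q' *\<^sub>v y)"
        let ?z = "Q' *\<^sub>v y - ?c \<cdot>\<^sub>v w"
        have z: "?z \<in> carrier_vec n" using Q'c PS0D[OF y] w by auto
        have "lift (g y) = ?z"
          unfolding g_def using z proj0[OF Q'c[OF PS0D(1)[OF y]]] by (rule lift_trunc)
        moreover have "Q *\<^sub>v ?z = y - ?c \<cdot>\<^sub>v u"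
          using Q Q'c PS0D[OF y] w
          by (simp add: mult_minus_distrib_mat_vec[of _ n n] mult_mat_vec_smult[of _ n n] QQ' Qw)
        \<comment> \<open>As \<open>y $ 0 = 0\<close> and \<open>u $ 0 = 1\<close>, the second
          subtraction has coefficient \<open>- ?c\<close> and undoes the first.\<close>
        ultimately have "h (g y) = (y - ?c \<cdot>\<^sub>v u) - (y - ?c \<cdot>\<^sub>v u) $ 0 \<cdot>\<^sub>v u"
          by (simp add: h_def)
        also have "\<dots> = y"
          using PS0D[OF y] n by (intro eq_vecI) (auto simp: u_def)
        finally show "h (g y) = y" .
      qed
      show "\<forall>x\<in>carrier ?T. g (h x) = x"
      proof
        fix x assume x: "x \<in> carrier ?T"
        let ?c = "(Q *\<^sub>v lift x) $ 0"
        have Qh: "Q' *\<^sub>v h x = lift x - ?c \<cdot>\<^sub>v w"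
          unfolding h_def using Q Q' lift u
          by (simp add: mult_minus_distrib_mat_vec[of _ n n] mult_mat_vec_smult[of _ n n] Q'Q w_def)
        \<comment> \<open>Hence \<open>g\<close> adds back exactly the multiple of \<open>w\<close>
          that \<open>h\<close> removed.\<close>
        have "lam (lift x - ?c \<cdot>\<^sub>v w) = - ?c"
          using lam_minus[OF lift smult_carrier_vec[THEN iffD2, OF w]] lam_smult[OF w w] lam_w lam_lift by simp
        then show "g (h x) = x"
          using x w unfolding g_def Qh by (intro eq_vecI) (auto simp: lift_def cT nl)
      qed
      show "g ` carrier (PS0_module n B) \<subseteq> carrier ?T"
      proof clarify
        fix y assume "y \<in> carrier (PS0_module n B)"
        then have y: "y \<in> PS0 n B" by (simp add: PS0_module_def)
        \<comment> \<open>The annihilation conditions are linear and hold for \<open>w\<close> by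
          \<open>Dw\<close>, so they survive the shift along \<open>w\<close>.\<close>
        have "of_nat (D ! i) * (a - c * b) = 0"
          if "of_nat (D ! i) * a = 0" "of_nat (D ! i) * b = 0" for i and a b c :: "'m mod_ring"
          using that by (simp add: right_diff_distrib mult.left_commute[of _ c])
        then show "g y \<in> carrier ?T"
          using PS0D[OF y] Dw w Q'c[OF PS0D(1)[OF y]] by (auto simp: g_def cT nl)
      qed
      show "h ` carrier ?T \<subseteq> carrier (PS0_module n B)"
      proof clarify
        fix x assume x: "x \<in> carrier ?T"
        have Ql: "Q *\<^sub>v lift x \<in> carrier_vec n" using Q lift by auto
        \<comment> \<open>The coordinate filled in by \<open>lift\<close> is free, so only the
          conditions on \<open>x\<close> have to be met.\<close>
        have "B *\<^sub>v (Q *\<^sub>v lift x) = 0\<^sub>v k"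
          using x unfolding kerD[OF lift] by (auto simp: lift_def nl cT)
        moreover have "B *\<^sub>v u = 0\<^sub>v k" using ones by (simp add: u_def)
        ultimately have "B *\<^sub>v h x = 0\<^sub>v k"
          unfolding h_def using B Ql u
          by (intro eq_vecI) (simp_all add: mult_minus_distrib_mat_vec[of _ k n] mult_mat_vec_smult[of _ k n])
        moreover have "h x \<in> carrier_vec n" "h x $ 0 = 0"
          using Ql u n by (auto simp: h_def) (simp add: u_def)
        ultimately show "h x \<in> carrier (PS0_module n B)"
          using B by (auto simp: PS0_module_def PS0_def)
      qed
    qed
    have "lam (0\<^sub>v n) = 0" using lam_minus[OF w w] w by simp
    then show "g \<zero>\<^bsub>PS0_module n B\<^esub> = \<zero>\<^bsub>?T\<^esub>"
      using Q' w by (intro eq_vecI)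
        (auto simp: g_def PS0_module_def annihilated_module_def module_vec_simps lenD nl mult_mat_vec_zero)
  next
    fix x y assume "x \<in> carrier (PS0_module n B)" "y \<in> carrier (PS0_module n B)"
    then have c: "x \<in> carrier_vec n" "y \<in> carrier_vec n" by (auto simp: PS0_module_def PS0_def)
    have "Q' *\<^sub>v (x + y) = Q' *\<^sub>v x + Q' *\<^sub>v y"
      using c Q' by (intro mult_add_distrib_mat_vec[of _ n n]) auto
    then show "g (x \<oplus>\<^bsub>PS0_module n B\<^esub> y) = g x \<oplus>\<^bsub>?T\<^esub> g y"
      using w c[THEN Q'c] lam_add[OF c[THEN Q'c]]
      by (intro eq_vecI) (auto simp: g_def PS0_module_def annihilated_module_def module_vec_simps nl algebra_simps carrier_matD[OF Q'(1)])
  next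
    fix a x assume "x \<in> carrier (PS0_module n B)"
    then have c: "x \<in> carrier_vec n" by (auto simp: PS0_module_def PS0_def)
    have "Q' *\<^sub>v (a \<cdot>\<^sub>v x) = a \<cdot>\<^sub>v (Q' *\<^sub>v x)"
      using c Q' by (intro mult_mat_vec_smult[of _ n n]) auto
    then show "g (a \<odot>\<^bsub>PS0_module n B\<^esub> x) = a \<odot>\<^bsub>?T\<^esub> g x"
      using w c[THEN Q'c] lam_smult[OF c[THEN Q'c] c[THEN Q'c]]
      by (intro eq_vecI) (auto simp: g_def PS0_module_def annihilated_module_def module_vec_simps nl algebra_simps carrier_matD[OF Q'(1)])
  qed
  from module_isomorphic_trans[OF this annihilated_module_isomorphic[OF Ddvd module_isomorphic_modules(2)[OF this]]]
  show "PS0_module n B \<cong>\<^sub>M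
      direct_sum_list (map cyclic_module (ds @ replicate (n - 1 - length ds) CARD('m)))"
    by (simp add: D_def l_def)
qed

text \<open>This yields \<open>1 \<le> r\<close>, because the incidence matrix of a hypergraph with
  a nonempty edge is not zero.\<close>

lemma smith_form_Nil_imp_zero:
  fixes B :: "'m::nontriv mod_ring mat"
  assumes B: "B \<in> carrier_mat k n" and smith: "has_smith_normal_form B []"
  shows "B = 0\<^sub>m k n"
proof -
  obtain P Q where P: "P \<in> carrier_mat k k" "invertible_mat P"
    and Q: "Q \<in> carrier_mat n n" "invertible_mat Q" and S: "smith_form (P * B * Q) []"
    using smith B by (auto simp: has_smith_normal_form_def)
  obtain P' where P': "P' \<in> carrier_mat k k" "P' * P = 1\<^sub>m k"
    using P by (elim invertible_matE) auto
  obtain Q' where Q': "Q' \<in> carrier_mat n n" "Q * Q' = 1\<^sub>m n"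
    using Q by (elim invertible_matE) auto
  have "P * B * Q = 0\<^sub>m k n"
    using S P B Q by (intro eq_matI) (auto simp: smith_form_def)
  then have "P * B * Q * Q' = 0\<^sub>m k n" using Q' by simp
  moreover have "P * B * Q * Q' = P * B * (Q * Q')"
    using P B Q Q' by (intro assoc_mult_mat[of _ k n _ n _ n]) auto
  ultimately have "P * B = 0\<^sub>m k n" using P B Q' by simp
  then have "P' * (P * B) = 0\<^sub>m k n" using P' by simp
  moreover have "P' * (P * B) = P' * P * B"
    using P P' B by (intro assoc_mult_mat[symmetric]) auto
  ultimately show ?thesis using P' B by simp
qed

section \<open>First Laplacian eigenvectors\<close>

text \<open>The equality case of the triangle inequality. After division by \<open>a\<close> the
  terms lie in the unit disc and their real parts, each at most 1, add up to the number of terms; so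
  every real part is 1, and the bound on the modulus leaves no imaginary part.\<close>

lemma sum_eq_card_mult_imp_eq:
  fixes c :: "'a \<Rightarrow> complex"
  assumes fin: "finite F" and sum: "(\<Sum>e\<in>F. c e) = of_nat (card F) * a"
    and le: "\<And>e. e \<in> F \<Longrightarrow> cmod (c e) \<le> cmod a" and e: "e \<in> F"
  shows "c e = a"
proof (cases "a = 0")
  case True
  then show ?thesis using le[OF e] by simp
next
  case a0: False
  define b where "b e = c e / a" for e
  have b1: "cmod (b e) \<le> 1" if "e \<in> F" for e
    using le[OF that] a0 by (simp add: b_def norm_divide)
  have "(\<Sum>e\<in>F. b e) = of_nat (card F)"
    using sum a0 by (simp add: b_def sum_divide_distrib[symmetric])
  then have "(\<Sum>e\<in>F. Re (b e)) = real (card F)"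
    by (metis Re_sum Re_complex_of_real of_real_of_nat_eq)
  then have "(\<Sum>e\<in>F. 1 - Re (b e)) = 0" by (simp add: sum_subtractf)
  moreover have "0 \<le> 1 - Re (b e)" if "e \<in> F" for e
    using b1[OF that] complex_Re_le_cmod[of "b e"] by linarith
  ultimately have re: "Re (b e) = 1"
    using sum_nonneg_eq_0_iff[OF fin, of "\<lambda>e. 1 - Re (b e)"] e by simp
  have "(Re (b e))\<^sup>2 + (Im (b e))\<^sup>2 \<le> 1"
    using b1[OF e] by (simp add: cmod_def)
  then have "Im (b e) = 0" using re by simp
  with re have "b e = 1" by (simp add: complex_eq_iff)
  then show ?thesis using a0 by (simp add: b_def)
qed

text \<open>The index lists that contribute to the adjacency part are the enumerations of e - {i}
  for the edges e through i. Each edge has (m - 1)! of them, which cancels the normalizing factor of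
  the tensor. The degree part leaves only the constant list.\<close>

lemma tensor_apply_laplacian:
  assumes unif: "uniform_hypergraph m n E" and m: "0 < m" and i: "i < n"
  shows "tensor_apply m n (laplacian_tensor m E) x $ i =
    of_nat (vertex_degree E i) * (x $ i) ^ (m - 1) - (\<Sum>e | e \<in> E \<and> i \<in> e. \<Prod>j\<in>e - {i}. x $ j)"
proof -
  let ?L = "{is. length is = m - 1 \<and> set is \<subseteq> {0..<n}}"
  let ?F = "{e. e \<in> E \<and> i \<in> e}"
  let ?p = "\<lambda>is. prod_list (map (\<lambda>j. x $ j) is)"
  have finL: "finite ?L" using finite_lists_length_eq[of "{0..<n}" "m - 1"] by (simp add: conj_commute)
  have esub: "e \<subseteq> {0..<n}" and ecard: "card e = m" if "e \<in> E" for e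
    using unif that by (auto simp: uniform_hypergraph_def)
  have efin: "finite e" if "e \<in> E" for e using esub[OF that] finite_subset by blast
  have "E \<subseteq> Pow {0..<n}" using esub by blast
  then have "finite E" by (rule finite_subset) simp
  then have finF: "finite ?F" by simp
  have "(\<Sum>is\<in>?L. degree_tensor E (i # is) * ?p is) =
    (\<Sum>is\<in>?L. if is = replicate (m - 1) i then of_nat (vertex_degree E i) * x $ i ^ (m - 1) else 0)"
  proof (rule sum.cong[OF refl])
    fix js assume js: "js \<in> ?L"
    have "set (i # js) = {i} \<longleftrightarrow> js = replicate (m - 1) i"
    proof
      assume "set (i # js) = {i}"
      then show "js = replicate (m - 1) i"
        using js by (intro replicate_eqI) auto
    qed (auto simp: set_replicate_conv_if)
    then show "degree_tensor E (i # js) * ?p js =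
      (if js = replicate (m - 1) i then of_nat (vertex_degree E i) * x $ i ^ (m - 1) else 0)"
      by (simp add: degree_tensor_def del: set_simps)
  qed
  also have "\<dots> = of_nat (vertex_degree E i) * x $ i ^ (m - 1)"
    using finL i by (simp add: sum.delta set_replicate_conv_if)
  finally have deg: "(\<Sum>is\<in>?L. degree_tensor E (i # is) * ?p is) = of_nat (vertex_degree E i) * x $ i ^ (m - 1)" .
  have sub: "permutations_of_set (e - {i}) \<subseteq> ?L" if "e \<in> ?F" for e
  proof
    fix js assume "js \<in> permutations_of_set (e - {i})"
    then have "set js = e - {i}" "distinct js" by (auto simp: permutations_of_set_def)
    then show "js \<in> ?L"
      using that esub[of e] ecard[of e] distinct_card[of js] efin[of e] by auto
  qed
  have iff: "set (i # js) \<in> E \<longleftrightarrow> (\<exists>e\<in>?F. js \<in> permutations_of_set (e - {i}))" if js: "js \<in> ?L" for js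
  proof
    assume "set (i # js) \<in> E"
    \<comment> \<open>An edge has as many vertices as the list has entries, which excludes
      repetitions, in particular of \<open>i\<close>.\<close>
    moreover from this have "card (set (i # js)) = length (i # js)" using ecard js m by simp
    then have "distinct (i # js)" by (rule card_distinct)
    ultimately have "set (i # js) \<in> ?F" "js \<in> permutations_of_set (set (i # js) - {i})"
      by (auto simp: permutations_of_set_def)
    then show "\<exists>e\<in>?F. js \<in> permutations_of_set (e - {i})" by blast
  next
    assume "\<exists>e\<in>?F. js \<in> permutations_of_set (e - {i})"
    then obtain e where "e \<in> E" "i \<in> e" "set js = e - {i}" by (auto simp: permutations_of_set_def)
    moreover from this have "set (i # js) = e" by auto
    ultimately show "set (i # js) \<in> E" by simp
  qed
  have "(\<Sum>is\<in>?L. adjacency_tensor m E (i # is) * ?p is) =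
    (\<Sum>is\<in>(\<Union>e\<in>?F. permutations_of_set (e - {i})). adjacency_tensor m E (i # is) * ?p is)"
  proof (rule sum.mono_neutral_right[OF finL])
    show "(\<Union>e\<in>?F. permutations_of_set (e - {i})) \<subseteq> ?L" using sub by blast
    show "\<forall>js\<in>?L - (\<Union>e\<in>?F. permutations_of_set (e - {i})). adjacency_tensor m E (i # js) * ?p js = 0"
    proof
      fix js assume "js \<in> ?L - (\<Union>e\<in>?F. permutations_of_set (e - {i}))"
      then have "set (i # js) \<notin> E" using iff by blast
      then show "adjacency_tensor m E (i # js) * ?p js = 0"
        by (simp only: adjacency_tensor_def if_False mult_zero_left)
    qed
  qed
  also have "\<dots> = (\<Sum>e\<in>?F. \<Sum>is\<in>permutations_of_set (e - {i}). adjacency_tensor m E (i # is) * ?p is)"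
  proof (rule sum.UNION_disjoint[OF finF])
    show "\<forall>e\<in>?F. \<forall>e'\<in>?F. e \<noteq> e' \<longrightarrow> permutations_of_set (e - {i}) \<inter> permutations_of_set (e' - {i}) = {}"
    proof (intro ballI impI)
      fix e e' assume "e \<in> ?F" "e' \<in> ?F" "e \<noteq> e'"
      moreover from this have "insert i (e - {i}) = e" "insert i (e' - {i}) = e'" by auto
      ultimately have "e - {i} \<noteq> e' - {i}" by metis
      then show "permutations_of_set (e - {i}) \<inter> permutations_of_set (e' - {i}) = {}"
        by (auto simp: permutations_of_set_def)
    qed
  qed simp
  also have "\<dots> = (\<Sum>e\<in>?F. \<Prod>j\<in>e - {i}. x $ j)"
  proof (rule sum.cong[OF refl])
    fix e assume e: "e \<in> ?F"
    have "adjacency_tensor m E (i # js) * ?p js = (\<Prod>j\<in>e - {i}. x $ j) / fact (m - 1)"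
      if "js \<in> permutations_of_set (e - {i})" for js
    proof -
      have js: "set js = e - {i}" "distinct js" using that by (auto simp: permutations_of_set_def)
      then have "set (i # js) = e" using e by auto
      moreover have "?p js = (\<Prod>j\<in>e - {i}. x $ j)"
        using js by (simp add: prod.distinct_set_conv_list[symmetric])
      ultimately show ?thesis using e by (simp add: adjacency_tensor_def del: list.set)
    qed
    then have "(\<Sum>is\<in>permutations_of_set (e - {i}). adjacency_tensor m E (i # is) * ?p is) =
      of_nat (card (permutations_of_set (e - {i}))) * ((\<Prod>j\<in>e - {i}. x $ j) / fact (m - 1))"
      by simp
    also have "card (permutations_of_set (e - {i})) = fact (m - 1)"
      using e ecard efin by simp
    finally show "(\<Sum>is\<in>permutations_of_set (e - {i}). adjacency_tensor m E (i # is) * ?p is) = (\<Prod>j\<in>e - {i}. x $ j)"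
      by simp
  qed
  finally have adj: "(\<Sum>is\<in>?L. adjacency_tensor m E (i # is) * ?p is) = (\<Sum>e\<in>?F. \<Prod>j\<in>e - {i}. x $ j)" .
  show ?thesis
    using i deg adj by (simp add: tensor_apply_def laplacian_tensor_def left_diff_distrib sum_subtractf)
qed

text \<open>Applied to the maximality of the modulus and to the common m-th power, both of which
  pass from one vertex of an edge to any other.\<close>

lemma connected_hypergraph_induct:
  assumes "connected_hypergraph n E" "u < n" "v < n" "R u"
    and "\<And>e a b. e \<in> E \<Longrightarrow> a \<in> e \<Longrightarrow> b \<in> e \<Longrightarrow> R a \<Longrightarrow> R b"
  shows "R v"
proof -
  have "(u, v) \<in> {(a, b). \<exists>e\<in>E. a \<in> e \<and> b \<in> e}\<^sup>*"
    using assms by (simp add: connected_hypergraph_def)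
  then show ?thesis
    by (induction rule: rtrancl_induct) (use assms in auto)
qed

lemma first_laplacian_eigenvector_edges:
  assumes unif: "uniform_hypergraph m n E" and m: "0 < m" and conn: "connected_hypergraph n E"
    and n: "0 < n" and x: "first_laplacian_eigenvector m n E x"
  shows "x $ 0 \<noteq> 0" and "\<And>i. i < n \<Longrightarrow> x $ i ^ m = x $ 0 ^ m"
    and "\<And>e. e \<in> E \<Longrightarrow> (\<Prod>j\<in>e. x $ j) = x $ 0 ^ m"
proof -
  have xc: "x \<in> carrier_vec n" and x0: "x \<noteq> 0\<^sub>v n"
    and eig: "tensor_apply m n (laplacian_tensor m E) x = 0\<^sub>v n"
    using x by (auto simp: first_laplacian_eigenvector_def)
  define M where "M = Max ((\<lambda>i. cmod (x $ i)) ` {..<n})"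
  have le: "cmod (x $ i) \<le> M" if "i < n" for i
    unfolding M_def using that by (intro Max_ge) auto
  have "M \<in> (\<lambda>i. cmod (x $ i)) ` {..<n}" unfolding M_def using n by (intro Max_in) auto
  then obtain i0 where i0: "i0 < n" "cmod (x $ i0) = M" by auto
  obtain j where "j < n" "x $ j \<noteq> 0" using x0 xc by (auto simp: vec_eq_iff)
  then have M0: "M > 0" using le[of j] by (metis less_le_trans zero_less_norm_iff)
  have esub: "e \<subseteq> {0..<n}" and ecard: "card e = m" if "e \<in> E" for e
    using unif that by (auto simp: uniform_hypergraph_def)
  have evert: "j < n" if "e \<in> E" "j \<in> e" for e j using esub[OF that(1)] that(2) by auto
  have efin: "finite e" if "e \<in> E" for e using esub[OF that] finite_subset by blast
  have "E \<subseteq> Pow {0..<n}" using esub by blast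
  then have finE: "finite E" by (rule finite_subset) simp
  \<comment> \<open>At a vertex of maximal modulus the eigenvalue equation is the equality case:
    there are as many edge products as the degree, each of modulus at most M ^ (m - 1).\<close>
  have edge: "(\<Prod>j\<in>e - {i}. x $ j) = x $ i ^ (m - 1)" if e: "e \<in> E" and i: "i \<in> e" and ci: "cmod (x $ i) = M" for e i
  proof (rule sum_eq_card_mult_imp_eq[where F = "{e \<in> E. i \<in> e}" and e = e and c = "\<lambda>e. \<Prod>j\<in>e - {i}. x $ j"])
    have "i < n" using e i by (rule evert)
    then have "of_nat (vertex_degree E i) * (x $ i) ^ (m - 1) = (\<Sum>e | e \<in> E \<and> i \<in> e. \<Prod>j\<in>e - {i}. x $ j)"
      using tensor_apply_laplacian[OF unif m, of i x] eig by simp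
    then show "(\<Sum>e\<in>{e \<in> E. i \<in> e}. \<Prod>j\<in>e - {i}. x $ j) = of_nat (card {e \<in> E. i \<in> e}) * x $ i ^ (m - 1)"
      by (simp add: vertex_degree_def)
    fix e' assume e': "e' \<in> {e \<in> E. i \<in> e}"
    have "cmod (\<Prod>j\<in>e' - {i}. x $ j) \<le> (\<Prod>j\<in>e' - {i}. M)"
      unfolding prod_norm[symmetric] using e' by (intro prod_mono conjI norm_ge_zero le evert[of e']) auto
    also have "\<dots> = M ^ (m - 1)" using e' ecard efin by simp
    finally show "cmod (\<Prod>j\<in>e' - {i}. x $ j) \<le> cmod (x $ i ^ (m - 1))"
      by (simp add: norm_power ci)
  qed (use finE e i in auto)
  have step: "cmod (x $ b) = M" if "e \<in> E" "a \<in> e" "b \<in> e" "cmod (x $ a) = M" for e a b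
  proof (cases "a = b")
    case False
    \<comment> \<open>The product over e - {a} has the largest possible modulus. Its factors other
      than \<open>b\<close> contribute at most M ^ (m - 2), so the factor at \<open>b\<close> must
      have modulus at least M.\<close>
    let ?P = "\<Prod>j\<in>e - {a} - {b}. cmod (x $ j)"
    have "cmod (x $ b) * ?P = (\<Prod>j\<in>e - {a}. cmod (x $ j))"
      using that efin False by (subst prod.remove[of "e - {a}" b]) auto
    also have "\<dots> = cmod (\<Prod>j\<in>e - {a}. x $ j)" by (simp add: prod_norm)
    also have "\<dots> = M ^ (m - 1)" using edge[OF that(1,2,4)] that(4) by (simp add: norm_power)
    finally have eq: "cmod (x $ b) * ?P = M ^ (m - 1)" .
    have cd: "card (e - {a}) = m - 1" using that ecard efin by simp
    then have "card (e - {a} - {b}) = m - 1 - 1" using that efin False by simp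
    moreover have "?P \<le> (\<Prod>j\<in>e - {a} - {b}. M)"
      by (intro prod_mono conjI norm_ge_zero le evert[OF that(1)]) auto
    ultimately have P: "?P \<le> M ^ (m - 1 - 1)" by simp
    have "e - {a} \<noteq> {}" using that(3) False by auto
    \<comment> \<open>Two distinct vertices in one edge give m \<ge> 2, so that the truncated
      exponent \<open>m - 1 - 1\<close> is the true one.\<close>
    then have "0 < m - 1" using cd efin[OF that(1)] card_gt_0_iff[of "e - {a}"] by simp
    then have "M * M ^ (m - 1 - 1) = cmod (x $ b) * ?P" unfolding eq by (cases "m - 1") auto
    also have "\<dots> \<le> cmod (x $ b) * M ^ (m - 1 - 1)" using P by (intro mult_left_mono) auto
    finally have "M \<le> cmod (x $ b)" using M0 by (simp add: mult_le_cancel_right)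
    moreover have "b < n" using that(1,3) by (rule evert)
    ultimately show ?thesis using le[of b] by simp
  qed (use that in simp)
  have cM: "cmod (x $ i) = M" if "i < n" for i
    by (rule connected_hypergraph_induct[OF conn i0(1) that, where R = "\<lambda>i. cmod (x $ i) = M"])
      (fact i0(2), rule step)
  show "x $ 0 \<noteq> 0" using cM[OF n] M0 by auto
  have prod: "(\<Prod>j\<in>e. x $ j) = x $ i ^ m" if e: "e \<in> E" and i: "i \<in> e" for e i
  proof -
    have "i < n" using e i by (rule evert)
    then have "(\<Prod>j\<in>e. x $ j) = x $ i * x $ i ^ (m - 1)"
      using edge[OF e i cM] prod.remove[OF efin[OF e] i, of "\<lambda>j. x $ j"] by simp
    then show ?thesis using m by (cases m) auto
  qed
  show pw: "x $ i ^ m = x $ 0 ^ m" if "i < n" for i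
  proof (rule connected_hypergraph_induct[OF conn n that, where R = "\<lambda>i. x $ i ^ m = x $ 0 ^ m"])
    fix e a b assume "e \<in> E" "a \<in> e" "b \<in> e" "x $ a ^ m = x $ 0 ^ m"
    then show "x $ b ^ m = x $ 0 ^ m" using prod[of e a] prod[of e b] by simp
  qed simp
  show "(\<Prod>j\<in>e. x $ j) = x $ 0 ^ m" if e: "e \<in> E" for e
  proof -
    have "e \<noteq> {}" using ecard[OF e] m by auto
    then obtain i where "i \<in> e" by blast
    then show ?thesis using prod[OF e] pw[of i] evert[OF e] by auto
  qed
qed

text \<open>Cancelling the nonzero \<open>x $ i\<close> from the edge product and from the m-th
  power turns each edge term at \<open>i\<close> into \<open>x $ i ^ (m - 1)\<close>, and the number
  of these terms is the degree.\<close>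

lemma first_laplacian_eigenvectorI:
  assumes unif: "uniform_hypergraph m n E" and m: "0 < m"
    and n: "0 < n" and x: "x \<in> carrier_vec n"
    and c: "c \<noteq> 0" and pw: "\<And>i. i < n \<Longrightarrow> x $ i ^ m = c"
    and prod: "\<And>e. e \<in> E \<Longrightarrow> (\<Prod>j\<in>e. x $ j) = c"
  shows "first_laplacian_eigenvector m n E x"
proof -
  have xi: "x $ i \<noteq> 0" if "i < n" for i using pw[OF that] c m by auto
  have Lx: "tensor_apply m n (laplacian_tensor m E) x $ i = 0" if i: "i < n" for i
  proof -
    have "(\<Prod>j\<in>e - {i}. x $ j) = x $ i ^ (m - 1)" if e: "e \<in> E" "i \<in> e" for e
    proof -
      have "e \<subseteq> {0..<n}" using unif e by (simp add: uniform_hypergraph_def)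
      then have "finite e" using finite_subset by blast
      then have "x $ i * (\<Prod>j\<in>e - {i}. x $ j) = c"
        using prod.remove[of e i "\<lambda>j. x $ j"] e(2) prod[OF e(1)] by simp
      also have "c = x $ i * x $ i ^ (m - 1)"
        unfolding pw[OF i, symmetric] using m by (cases m) simp_all
      finally have "x $ i * (\<Prod>j\<in>e - {i}. x $ j) = x $ i * x $ i ^ (m - 1)" .
      then show ?thesis using xi[OF i] by simp
    qed
    then show ?thesis
      by (simp add: tensor_apply_laplacian[OF unif m i] vertex_degree_def)
  qed
  have "tensor_apply m n (laplacian_tensor m E) x = 0\<^sub>v n"
  proof (rule eq_vecI)
    show "dim_vec (tensor_apply m n (laplacian_tensor m E) x) = dim_vec (0\<^sub>v n :: complex vec)"
      by (simp add: tensor_apply_def)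
  qed (simp add: Lx)
  moreover have "x \<noteq> 0\<^sub>v n" using xi[OF n] n by auto
  ultimately show ?thesis
    using x by (simp add: first_laplacian_eigenvector_def)
qed

section \<open>The isomorphism of Z_m with the m-th roots of unity\<close>

definition root_char :: "'m::nontriv mod_ring \<Rightarrow> complex" where
  "root_char a = cis (2 * pi * real_of_int (to_int_mod_ring a) / real CARD('m))"

text \<open>Reduction modulo m shifts the angle by a multiple of 2 pi. Any integer representative
  may therefore be used, which reduces the laws of \<open>root_char\<close> to those of
  \<open>cis\<close>.\<close>

lemma root_char_of_int: "root_char (of_int k :: 'm::nontriv mod_ring) = cis (2 * pi * real_of_int k / real CARD('m))"
proof -
  have "to_int_mod_ring (of_int k :: 'm mod_ring) = k mod int CARD('m)"
    by transfer simp
  also have "\<dots> = k - int CARD('m) * (k div int CARD('m))"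
    by (simp add: minus_mult_div_eq_mod)
  finally have "real_of_int (to_int_mod_ring (of_int k :: 'm mod_ring)) =
    real_of_int k - real CARD('m) * real_of_int (k div int CARD('m))"
    by simp
  then have "2 * pi * real_of_int (to_int_mod_ring (of_int k :: 'm mod_ring)) / real CARD('m) =
    2 * pi * real_of_int k / real CARD('m) - 2 * pi * real_of_int (k div int CARD('m))"
    by (simp add: right_diff_distrib diff_divide_distrib)
  then show ?thesis
    by (simp add: root_char_def cis_divide[symmetric] cis_multiple_2pi)
qed

lemma root_char_0 [simp]: "root_char 0 = 1"
  by (simp add: root_char_def)

lemma root_char_add: "root_char (a + b) = root_char a * root_char (b :: 'm::nontriv mod_ring)"
proof -
  have "root_char (of_int (to_int_mod_ring a + to_int_mod_ring b) :: 'm mod_ring) = root_char a * root_char b"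
    unfolding root_char_of_int by (simp add: root_char_def cis_mult add_divide_distrib distrib_left)
  then show ?thesis by (simp add: of_int_to_int_mod_ring)
qed

lemma root_char_sum: "root_char (\<Sum>i\<in>A. f i :: 'm::nontriv mod_ring) = (\<Prod>i\<in>A. root_char (f i))"
  by (induction A rule: infinite_finite_induct) (simp_all add: root_char_add)

text \<open>The exponent is the representative used by the scalar action of
  \<open>PV0_module\<close>.\<close>

lemma root_char_mult: "root_char (k * a :: 'm::nontriv mod_ring) = root_char a ^ nat (to_int_mod_ring k)"
proof -
  have "root_char (of_int (to_int_mod_ring k * to_int_mod_ring a) :: 'm mod_ring) =
    cis (real (nat (to_int_mod_ring k)) * (2 * pi * real_of_int (to_int_mod_ring a) / real CARD('m)))"
    unfolding root_char_of_int using to_int_mod_ring_range(1)[of k] by (simp add: mult_ac)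
  then show ?thesis by (simp add: of_int_to_int_mod_ring root_char_def DeMoivre)
qed

text \<open>Injectivity makes solutions recoverable from eigenvectors; surjectivity provides
  logarithms of the quotients of coordinates.\<close>

lemma bij_betw_root_char:
  "bij_betw (root_char :: 'm::nontriv mod_ring \<Rightarrow> complex) UNIV {z. z ^ CARD('m) = 1}"
proof -
  have "bij_betw (nat \<circ> to_int_mod_ring :: 'm mod_ring \<Rightarrow> nat) UNIV {..<CARD('m)}"
  proof (rule bij_betw_byWitness[where f' = of_nat])
    show "\<forall>a\<in>UNIV. of_nat ((nat \<circ> to_int_mod_ring) a) = (a :: 'm mod_ring)"
    proof
      fix a :: "'m mod_ring"
      have "of_nat (nat (to_int_mod_ring a)) = (of_int (int (nat (to_int_mod_ring a))) :: 'm mod_ring)"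
        by (rule of_int_of_nat_eq[symmetric])
      then show "of_nat ((nat \<circ> to_int_mod_ring) a) = a"
        using to_int_mod_ring_range(1)[of a] by (simp add: of_int_to_int_mod_ring)
    qed
    show "\<forall>a\<in>{..<CARD('m)}. (nat \<circ> to_int_mod_ring) (of_nat a :: 'm mod_ring) = a"
      by (simp add: of_nat_of_int_mod_ring)
    show "(nat \<circ> to_int_mod_ring :: 'm mod_ring \<Rightarrow> nat) ` UNIV \<subseteq> {..<CARD('m)}"
      using to_int_mod_ring_range[where 'm = 'm] by (auto simp: nat_less_iff)
  qed simp
  from bij_betw_trans[OF this bij_betw_roots_unity[of "CARD('m)"]]
  have "bij_betw ((\<lambda>k. cis (2 * pi * real k / real CARD('m))) \<circ> (nat \<circ> to_int_mod_ring :: 'm mod_ring \<Rightarrow> nat))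
    UNIV {z. z ^ CARD('m) = 1}" by simp
  moreover have "(\<lambda>k. cis (2 * pi * real k / real CARD('m))) \<circ> (nat \<circ> to_int_mod_ring) =
    (root_char :: 'm mod_ring \<Rightarrow> complex)"
    using to_int_mod_ring_range(1)[where 'm = 'm] by (auto simp: root_char_def)
  ultimately show ?thesis by simp
qed

lemma root_char_eq_iff: "root_char a = root_char b \<longleftrightarrow> a = (b :: 'm::nontriv mod_ring)"
  using bij_betw_root_char[where 'm = 'm] by (auto simp: bij_betw_def inj_on_def)

lemma root_char_power: "root_char (a :: 'm::nontriv mod_ring) ^ CARD('m) = 1"
  using bij_betw_root_char[where 'm = 'm] by (auto simp: bij_betw_def)

section \<open>Projective points and their normalized vectors\<close>

lemma normalized_rep_proj_point:
  assumes "x \<in> carrier_vec n" "0 < n" "x $ 0 = 1"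
  shows "normalized_rep (proj_point x) = x"
  unfolding normalized_rep_def proj_point_def
  by (rule the_equality) (use assms in \<open>auto intro: exI[of _ 1]\<close>)

lemma proj_point_smult:
  assumes "c \<noteq> 0" shows "proj_point (c \<cdot>\<^sub>v x) = proj_point x"
proof -
  have "d \<cdot>\<^sub>v x \<in> proj_point (c \<cdot>\<^sub>v x)" if "d \<noteq> 0" for d
    unfolding proj_point_def using assms that
    by (intro CollectI exI[of _ "d / c"]) (simp add: smult_smult_assoc)
  moreover have "d \<cdot>\<^sub>v (c \<cdot>\<^sub>v x) \<in> proj_point x" if "d \<noteq> 0" for d
    unfolding proj_point_def using assms that
    by (intro CollectI exI[of _ "d * c"]) (simp add: smult_smult_assoc)
  ultimately show ?thesis by (auto simp: proj_point_def)
qed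

text \<open>The coordinatewise character turns sums over edges into products over edges and the
  condition \<open>y $ 0 = 0\<close> into the normalization of the representative. The map starts at
  the solutions because their module axioms are the known ones.\<close>

lemma PV0_module_isomorphic:
  fixes B :: "'m::nontriv mod_ring mat"
  assumes unif: "uniform_hypergraph CARD('m) n E" and conn: "connected_hypergraph n E" and n: "0 < n"
    and es: "set es = E" and B: "B = incidence_mat n es"
    and md: "Module.module class_ring (PS0_module n B)"
  shows "PS0_module n B \<cong>\<^sub>M PV0_module n E"
proof -
  have esub: "e \<subseteq> {0..<n}" if "e \<in> E" for e
    using unif that by (auto simp: uniform_hypergraph_def)
  have "(B *\<^sub>v y) $ i = (\<Sum>j\<in>es ! i. y $ j)" if "y \<in> carrier_vec n" "i < length es" for y i
  proof -
    have "(B *\<^sub>v y) $ i = (\<Sum>j\<in>{0..<n}. if j \<in> es ! i then y $ j else 0)"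
      using that by (auto simp: B incidence_mat_def scalar_prod_def intro!: sum.cong)
    also have "\<dots> = (\<Sum>j\<in>{0..<n} \<inter> es ! i. y $ j)"
      by (simp add: sum.inter_restrict)
    also have "{0..<n} \<inter> es ! i = es ! i" using esub[of "es ! i"] that es nth_mem by blast
    finally show ?thesis .
  qed
  then have PS0: "y \<in> PS0 n B \<longleftrightarrow> y \<in> carrier_vec n \<and> (\<forall>e\<in>E. (\<Sum>j\<in>e. y $ j) = 0) \<and> y $ 0 = 0" for y
    unfolding PS0_def es[symmetric] by (auto simp: vec_eq_iff all_set_conv_all_nth B incidence_mat_def)
  define F where "F y = vec n (\<lambda>i. root_char (y $ i))" for y :: "'m mod_ring vec"
  have F: "F y \<in> carrier_vec n" "F y $ 0 = 1" if "y \<in> PS0 n B" for y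
    using that n by (auto simp: F_def PS0)
  have nF: "normalized_rep (proj_point (F y)) = F y" if "y \<in> PS0 n B" for y
    using F[OF that] n by (intro normalized_rep_proj_point)
  have eF: "first_laplacian_eigenvector CARD('m) n E (F y)" if y: "y \<in> PS0 n B" for y
  proof (rule first_laplacian_eigenvectorI[OF unif _ n, where c = 1])
    fix e assume e: "e \<in> E"
    have "(\<Prod>j\<in>e. F y $ j) = (\<Prod>j\<in>e. root_char (y $ j))"
      using esub[OF e] by (intro prod.cong) (auto simp: F_def)
    also have "\<dots> = root_char (\<Sum>j\<in>e. y $ j)" by (simp add: root_char_sum)
    finally show "(\<Prod>j\<in>e. F y $ j) = 1" using y e by (simp add: PS0)
  qed (use F[OF y] in \<open>auto simp: F_def root_char_power\<close>)
  have surj: "\<exists>y\<in>PS0 n B. proj_point x = proj_point (F y)" if x: "first_laplacian_eigenvector CARD('m) n E x" for x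
  proof -
    note ev = first_laplacian_eigenvector_edges[OF unif _ conn n x, simplified]
    have xc: "x \<in> carrier_vec n" using x by (simp add: first_laplacian_eigenvector_def)
    have "\<exists>a :: 'm mod_ring. root_char a = x $ i / x $ 0" if "i < n" for i
    proof -
      \<comment> \<open>All m-th powers of coordinates agree, so the quotients have logarithms in
        Z_m.\<close>
      have "(x $ i / x $ 0) ^ CARD('m) = 1" using ev(1) ev(2)[OF that] by (simp add: power_divide)
      then have "x $ i / x $ 0 \<in> range (root_char :: 'm mod_ring \<Rightarrow> complex)"
        using bij_betw_imp_surj_on[OF bij_betw_root_char[where 'm = 'm]] by simp
      then show ?thesis by auto
    qed
    then obtain a :: "nat \<Rightarrow> 'm mod_ring" where a: "\<And>i. i < n \<Longrightarrow> root_char (a i) = x $ i / x $ 0"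
      by metis
    have Fa: "F (vec n a) = (1 / x $ 0) \<cdot>\<^sub>v x"
      using xc a by (intro eq_vecI) (auto simp: F_def)
    have "(\<Sum>j\<in>e. vec n a $ j) = 0" if e: "e \<in> E" for e
    proof -
      \<comment> \<open>An edge has m vertices, so dividing each factor by \<open>x $ 0\<close>
        divides the edge product by \<open>x $ 0 ^ m\<close>, which is its value.\<close>
      have "root_char (\<Sum>j\<in>e. vec n a $ j) = (\<Prod>j\<in>e. x $ j / x $ 0)"
        unfolding root_char_sum using esub[OF e] a by (intro prod.cong) auto
      also have "\<dots> = (\<Prod>j\<in>e. x $ j) / x $ 0 ^ card e" by (simp add: prod_dividef)
      also have "\<dots> = 1" using ev(1) ev(3)[OF e] unif e by (simp add: uniform_hypergraph_def)
      finally show ?thesis using root_char_eq_iff[of "\<Sum>j\<in>e. vec n a $ j" 0] by simp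
    qed
    moreover have "vec n a $ 0 = 0" using a[OF n] ev(1) n root_char_eq_iff[of "a 0" 0] by simp
    ultimately have "vec n a \<in> PS0 n B" by (simp add: PS0)
    moreover have "proj_point x = proj_point (F (vec n a))"
      unfolding Fa using ev(1) by (simp add: proj_point_smult)
    ultimately show ?thesis by blast
  qed
  let ?V = "PV0_module n E :: ('m mod_ring, complex vec set) module"
  show ?thesis
  proof (rule module_isomorphicI[OF md, where f = "\<lambda>y. proj_point (F y)"])
    show "bij_betw (\<lambda>y. proj_point (F y)) (carrier (PS0_module n B)) (carrier (?V))"
    proof (rule bij_betw_imageI)
      show "inj_on (\<lambda>y. proj_point (F y)) (carrier (PS0_module n B))"
      proof (rule inj_onI)
        fix y y' assume y: "y \<in> carrier (PS0_module n B)" "y' \<in> carrier (PS0_module n B)"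
          and eq: "proj_point (F y) = proj_point (F y')"
        have "y \<in> PS0 n B" "y' \<in> PS0 n B" using y by (simp_all add: PS0_module_def)
        then have "F y = F y'" using arg_cong[OF eq, of normalized_rep] by (simp add: nF)
        then have "F y $ i = F y' $ i" for i by simp
        then have Fi: "F y $ i = F y' $ i" for i .
        have "y $ i = y' $ i" if "i < n" for i
          using Fi[of i] that by (simp add: F_def root_char_eq_iff)
        then show "y = y'" using y by (intro eq_vecI) (auto simp: PS0_module_def PS0)
      qed
      show "(\<lambda>y. proj_point (F y)) ` carrier (PS0_module n B) = carrier (?V)"
      proof (intro equalityI subsetI)
        fix p assume "p \<in> (\<lambda>y. proj_point (F y)) ` carrier (PS0_module n B)"
        then show "p \<in> carrier (?V)"
          using eF by (auto simp: PS0_module_def PV0_module_def PV0_def)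
      next
        fix p assume "p \<in> carrier (?V)"
        then obtain x where "first_laplacian_eigenvector CARD('m) n E x" "p = proj_point x"
          by (auto simp: PV0_module_def PV0_def)
        then show "p \<in> (\<lambda>y. proj_point (F y)) ` carrier (PS0_module n B)"
          using surj[of x] by (auto simp: PS0_module_def)
      qed
    qed
    show "proj_point (F \<zero>\<^bsub>PS0_module n B\<^esub>) = \<zero>\<^bsub>?V\<^esub>"
      by (auto simp: PS0_module_def PV0_module_def module_vec_simps F_def intro!: arg_cong[where f = proj_point])
  next
    fix x y assume "x \<in> carrier (PS0_module n B)" "y \<in> carrier (PS0_module n B)"
    then have xy: "x \<in> PS0 n B" "y \<in> PS0 n B" by (simp_all add: PS0_module_def)
    have "F (x + y) = vec n (\<lambda>i. F x $ i * F y $ i)"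
      using xy by (intro eq_vecI) (auto simp: F_def PS0 root_char_add)
    then show "proj_point (F (x \<oplus>\<^bsub>PS0_module n B\<^esub> y)) = proj_point (F x) \<oplus>\<^bsub>?V\<^esub> proj_point (F y)"
      by (simp add: PS0_module_def PV0_module_def module_vec_simps nF xy)
  next
    fix k x assume "x \<in> carrier (PS0_module n B)"
    then have x: "x \<in> PS0 n B" by (simp add: PS0_module_def)
    have "F (k \<cdot>\<^sub>v x) = vec n (\<lambda>i. F x $ i ^ nat (to_int_mod_ring k))"
      using x by (intro eq_vecI) (auto simp: F_def PS0 root_char_mult)
    then show "proj_point (F (k \<odot>\<^bsub>PS0_module n B\<^esub> x)) = k \<odot>\<^bsub>?V\<^esub> proj_point (F x)"
      by (simp add: PS0_module_def PV0_module_def module_vec_simps nF x)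
  qed
qed

theorem theorem3p4:
  fixes m n r :: nat
    and E :: "nat set set"
    and es :: "nat set list"
    and B :: "'m::nontriv mod_ring mat"
    and ds :: "nat list"
  assumes "m = CARD('m)"
    and "2 \<le> n"
    and "uniform_hypergraph m n E"
    and "connected_hypergraph n E"
    and "distinct es" and "set es = E"
    and "B = incidence_mat n es"
    and "has_smith_normal_form B ds"
    and "r = length ds"
  shows "1 \<le> r \<and> r \<le> n - 1 \<and>
    (PV0_module n E :: ('m mod_ring, complex vec set) module) \<cong>\<^sub>M PS0_module n B \<and>
    PS0_module n B \<cong>\<^sub>M
      direct_sum_list (map cyclic_module (filter (\<lambda>d. d \<noteq> 1) ds @ replicate (n - 1 - r) m)) \<and>
    card (PV0 m n E) = m ^ (n - 1 - r) * (\<Prod>i<r. ds ! i) \<and>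
    composition_length (PV0_module n E :: ('m mod_ring, complex vec set) module) =
      (\<Sum>d\<leftarrow>filter (\<lambda>d. d \<noteq> 1) ds. cl d) + (n - 1 - r) * cl m"
proof -
  let ?V = "PV0_module n E :: ('m mod_ring, complex vec set) module"
  define D where "D = ds @ replicate (n - 1 - r) m"
  have n: "0 < n" using \<open>2 \<le> n\<close> by simp
  have m: "1 < m" using nontriv[where 'a = 'm] \<open>m = CARD('m)\<close> by simp
  have Bc: "B \<in> carrier_mat (length es) n"
    using \<open>B = incidence_mat n es\<close> by (simp add: incidence_mat_def)
  have edge: "e \<subseteq> {0..<n}" "card e = m" if "e \<in> E" for e
    using \<open>uniform_hypergraph m n E\<close> that by (auto simp: uniform_hypergraph_def)
  \<comment> \<open>Every row sum is the size m of an edge, hence 0 in Z_m.\<close>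
  have ones: "B *\<^sub>v vec n (\<lambda>_. 1) = 0\<^sub>v (length es)"
  proof (rule eq_vecI)
    fix i assume "i < dim_vec (0\<^sub>v (length es) :: 'm mod_ring vec)"
    then have i: "i < length es" by simp
    then have e: "es ! i \<in> E" using \<open>set es = E\<close> by auto
    have "(B *\<^sub>v vec n (\<lambda>_. 1)) $ i = (\<Sum>j\<in>{0..<n}. if j \<in> es ! i then 1 else 0)"
      unfolding \<open>B = incidence_mat n es\<close> using i
      by (auto simp: incidence_mat_def scalar_prod_def intro!: sum.cong)
    also have "\<dots> = of_nat (card ({0..<n} \<inter> es ! i))"
      by (simp add: sum.inter_restrict[symmetric])
    also have "{0..<n} \<inter> es ! i = es ! i" using edge[OF e] by blast
    finally show "(B *\<^sub>v vec n (\<lambda>_. 1)) $ i = 0\<^sub>v (length es) $ i"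
      using edge(2)[OF e] i by (simp only: \<open>m = CARD('m)\<close> of_nat_card_eq_0 index_zero_vec)
  qed (use Bc in simp)
  note iso = PS0_module_isomorphic[OF Bc n ones \<open>has_smith_normal_form B ds\<close>]
  have rn: "r \<le> n - 1" using iso(1) \<open>r = length ds\<close> by simp
  have D: "PS0_module n B \<cong>\<^sub>M direct_sum_list (map cyclic_module D)"
    using iso(2) \<open>r = length ds\<close> \<open>m = CARD('m)\<close> by (simp add: D_def)
  have "ds \<noteq> []"
  proof
    assume "ds = []"
    then have B0: "B = 0\<^sub>m (length es) n"
      using smith_form_Nil_imp_zero[OF Bc] \<open>has_smith_normal_form B ds\<close> by simp
    \<comment> \<open>With at least two vertices the path from 0 to 1 is not empty, and its first
      step gives an edge at 0, that is, a nonzero entry of \<open>B\<close>.\<close>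
    have "(0, 1) \<in> {(a, b). \<exists>e\<in>E. a \<in> e \<and> b \<in> e}\<^sup>*"
      using \<open>connected_hypergraph n E\<close> \<open>2 \<le> n\<close> by (simp add: connected_hypergraph_def)
    then have "\<exists>e\<in>E. 0 \<in> e"
    proof (cases rule: converse_rtranclE)
      case (step y)
      then show ?thesis by blast
    qed simp
    then obtain i where "i < length es" "0 \<in> es ! i"
      using \<open>set es = E\<close> by (auto simp: in_set_conv_nth)
    then have "B $$ (i, 0) = 1"
      unfolding \<open>B = incidence_mat n es\<close> using n by (simp add: incidence_mat_def)
    then show False using B0 \<open>i < length es\<close> n by simp
  qed
  then have r1: "1 \<le> r" using \<open>r = length ds\<close> by (cases ds) auto
  have V: "?V \<cong>\<^sub>M PS0_module n B"
  proof (rule module_isomorphic_sym, rule PV0_module_isomorphic)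
    show "uniform_hypergraph CARD('m) n E"
      using \<open>uniform_hypergraph m n E\<close> unfolding \<open>m = CARD('m)\<close> .
    show "Module.module class_ring (PS0_module n B)" using D by (rule module_isomorphic_modules)
  qed (fact \<open>connected_hypergraph n E\<close> n \<open>set es = E\<close> \<open>B = incidence_mat n es\<close>)+
  obtain P Q where "smith_form (P * B * Q) ds"
    using \<open>has_smith_normal_form B ds\<close> by (auto simp: has_smith_normal_form_def)
  then have "\<forall>d\<in>set ds. d dvd CARD('m)"
    by (auto simp: smith_form_def in_set_conv_nth)
  then have Ddvd: "d dvd CARD('m)" if "d \<in> set D" for d
    using that \<open>m = CARD('m)\<close> unfolding D_def by auto
  \<comment> \<open>The free summands survive the filter because m > 1.\<close>
  have filter: "filter (\<lambda>d. d \<noteq> 1) D = filter (\<lambda>d. d \<noteq> 1) ds @ replicate (n - 1 - r) m"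
    using m by (simp add: D_def)
  have PS: "PS0_module n B \<cong>\<^sub>M
      direct_sum_list (map cyclic_module (filter (\<lambda>d. d \<noteq> 1) ds @ replicate (n - 1 - r) m))"
    using module_isomorphic_trans[OF D iso_direct_sum_filter_cyclic[OF Ddvd]] unfolding filter .
  \<comment> \<open>Counting uses the unfiltered list, whose product runs over all invariant
    divisors.\<close>
  have "card (carrier ?V) = prod_list D"
    using module_isomorphic_card[OF module_isomorphic_trans[OF V D]] by (simp only: card_carrier_direct_sum_cyclic)
  moreover have "prod_list ds = (\<Prod>i<r. ds ! i)"
    using \<open>r = length ds\<close> by (simp add: prod.list_conv_set_nth lessThan_atLeast0)
  ultimately have card: "card (PV0 m n E) = m ^ (n - 1 - r) * (\<Prod>i<r. ds ! i)"
    using \<open>m = CARD('m)\<close> by (simp add: D_def PV0_module_def mult.commute)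
  have "composition_length ?V = (\<Sum>d\<leftarrow>filter (\<lambda>d. d \<noteq> 1) ds @ replicate (n - 1 - r) m. cl d)"
    by (rule composition_length_direct_sum_cyclic[OF module_isomorphic_trans[OF V PS]])
      (rule Ddvd, auto simp: D_def)
  then have "composition_length ?V = (\<Sum>d\<leftarrow>filter (\<lambda>d. d \<noteq> 1) ds. cl d) + (n - 1 - r) * cl m"
    by (simp add: sum_list_replicate)
  with r1 rn V PS card show ?thesis by (intro conjI)
qed

end
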